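(* Let $G_4$ be the degree-$4$ universal group for homotopy of Gauss words. Then $G_4\cong\mathbb{Z}\oplus\mathbb{Z}/2\mathbb{Z}$. Moreover, if two Gauss words $w$ and $w'$ can be distinguished by a finite type invariant of degree $4$ (i.e. $v(w)\neq v(w')$ for some finite type invariant $v$ of degree $4$ for homotopy of Gauss words), then they can be distinguished by $v_4$, i.e. $v_4(w)\neq v_4(w')$.
   Context: A Gauss word is a finite word (possibly empty) in which every letter that occurs occurs exactly twice. Two Gauss words are isomorphic if a bijection of their letter sets carries one to the other letterwise. The rank of a Gauss word is its number of distinct letters. Homotopy of Gauss words is the equivalence relation generated by isomorphism and the moves (in both directions) $xAAy\leftrightarrow xy$, $xAByBAz\leftrightarrow xyz$, $xAByACzBCt\leftrightarrow xBAyCAzCBt$, where $x,y,z,t$ are arbitrary sequences of letters such that both sides are Gauss words. (This is the nanoword homotopy with $\alpha=\{a\}$, $\tau=\mathrm{id}$, $S=\{(a,a,a)\}$.) Finite type invariants. A homotopy invariant is a function on homotopy classes of Gauss words with values in an additive abelian group, extended linearly to the free abelian group on these classes. A Gauss word with a letter $A$ marked as a semi-letter $\dot A$ denotes $x\dot Ay\dot Az=xAyAz-xyz$, applied recursively for several semi-letters. A homotopy invariant $v$ is a finite type invariant if there is an integer $n$ such that $v$ vanishes on every Gauss word with more than $n$ semi-letters; the least such $n\ge0$ is the degree of $v$. The group $G_4$ is the quotient of the free abelian group on isomorphism classes of Gauss words by the relations ($x,y,z,t$ arbitrary sequences of letters such that all terms are Gauss words): (1) $xAAy=0$; (2) $xAByBAz+xAyAz+xByBz=0$;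 (3) $xAByACzBCt+xAByAzBt+xAyACzCt+xByCzBCt=xBAyCAzCBt+xBAyAzBt+xAyCAzCt+xByCzCBt$; (4) $p=0$ for every Gauss word $p$ of rank greater than $4$. The invariant $v_4$. For Gauss words $q,w$, a subword of $w$ here means a Gauss word obtained from $w$ by deleting a (possibly empty) set of letters (both occurrences of each), and $\langle q,w\rangle$ is the number of such subwords (counted by subsets of letters, so a rank $n$ word has $2^n$ subwords) isomorphic to $q$; it is extended linearly in $q$. Put $w_1=ABACDCBD$, $w_2=ABCACDBD$, $w_3=ABCADBDC$, $w_4=ABCBDACD$, $w_5=ABCDBDAC$, $w_6=ABCDCADB$, and $v_4(w)=\langle\sum_{i=1}^6 w_i,w\rangle \bmod 2\in\mathbb{Z}/2\mathbb{Z}$. *)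

theory Defs
  imports "HOL-Algebra.Free_Abelian_Groups" "HOL-Algebra.Coset"
begin

section \<open>Gauss words\<close>

text \<open>Letters are natural numbers: every Gauss word is finite, hence isomorphic to one over any
  fixed infinite alphabet.\<close>

type_synonym word = "nat list"

definition gauss_word :: "word \<Rightarrow> bool" where
  "gauss_word w \<longleftrightarrow> (\<forall>a\<in>set w. count_list w a = 2)"

definition rank :: "word \<Rightarrow> nat" where
  "rank w = card (set w)"

definition isomorphic :: "word \<Rightarrow> word \<Rightarrow> bool" where
  "isomorphic u w \<longleftrightarrow> (\<exists>f. bij_betw f (set u) (set w) \<and> map f u = w)"

definition delete_letters :: "nat set \<Rightarrow> word \<Rightarrow> word" where
  "delete_letters S w = filter (\<lambda>a. a \<notin> S) w"

section \<open>Homotopy\<close>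

inductive homotopy_move :: "word \<Rightarrow> word \<Rightarrow> bool" where
  iso: "gauss_word u \<Longrightarrow> gauss_word w \<Longrightarrow> isomorphic u w \<Longrightarrow> homotopy_move u w"
| H1: "gauss_word (x @ [A, A] @ y) \<Longrightarrow> gauss_word (x @ y) \<Longrightarrow>
    homotopy_move (x @ [A, A] @ y) (x @ y)"
| H2: "gauss_word (x @ [A, B] @ y @ [B, A] @ z) \<Longrightarrow> gauss_word (x @ y @ z) \<Longrightarrow>
    homotopy_move (x @ [A, B] @ y @ [B, A] @ z) (x @ y @ z)"
| H3: "gauss_word (x @ [A, B] @ y @ [A, C] @ z @ [B, C] @ t) \<Longrightarrow>
    gauss_word (x @ [B, A] @ y @ [C, A] @ z @ [C, B] @ t) \<Longrightarrow>
    homotopy_move (x @ [A, B] @ y @ [A, C] @ z @ [B, C] @ t)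
                  (x @ [B, A] @ y @ [C, A] @ z @ [C, B] @ t)"

definition homotopy_rel :: "word rel" where
  "homotopy_rel = {(u, w). gauss_word u \<and> gauss_word w \<and> equivclp homotopy_move u w}"

definition homotopy_class :: "word \<Rightarrow> word set" where
  "homotopy_class w = homotopy_rel `` {w}"

definition homotopy_classes :: "word set set" where
  "homotopy_classes = {w. gauss_word w} // homotopy_rel"

section \<open>Finite type invariants\<close>

text \<open>An additive abelian group is a (multiplicatively written) \<^const>\<open>comm_group\<close> \<open>H\<close>.\<close>

definition homotopy_invariant :: "('h, 'm) monoid_scheme \<Rightarrow> (word set \<Rightarrow> 'h) \<Rightarrow> bool" where
  "homotopy_invariant H v \<longleftrightarrow> v \<in> homotopy_classes \<rightarrow> carrier H"

text \<open>The linear extension \<open>\<Sum>\<^sub>c n\<^sub>c c \<mapsto> \<Sum>\<^sub>c n\<^sub>c v(c)\<close> to the free abelian group on homotopy classes.\<close>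

definition linear_ext ::
    "('h, 'm) monoid_scheme \<Rightarrow> (word set \<Rightarrow> 'h) \<Rightarrow> (word set \<Rightarrow>\<^sub>0 int) \<Rightarrow> 'h" where
  "linear_ext H v p =
    finprod H (\<lambda>c. v c [^]\<^bsub>H\<^esub> Poly_Mapping.lookup p c) (Poly_Mapping.keys p)"

text \<open>\<open>semi_word w As\<close> is the Gauss word \<open>w\<close> in which the letters of the list \<open>As\<close> are marked as
  semi-letters, as an element of the free abelian group on homotopy classes. It is only used
  for distinct letters \<open>As\<close> of \<open>w\<close>.\<close>

fun semi_word :: "word \<Rightarrow> nat list \<Rightarrow> (word set \<Rightarrow>\<^sub>0 int)" where
  "semi_word w [] = frag_of (homotopy_class w)"
| "semi_word w (A # As) = semi_word w As - semi_word (delete_letters {A} w) As"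

definition vanishes_above :: "('h, 'm) monoid_scheme \<Rightarrow> (word set \<Rightarrow> 'h) \<Rightarrow> nat \<Rightarrow> bool" where
  "vanishes_above H v n \<longleftrightarrow>
    (\<forall>w As. gauss_word w \<and> distinct As \<and> set As \<subseteq> set w \<and> length As > n
       \<longrightarrow> linear_ext H v (semi_word w As) = \<one>\<^bsub>H\<^esub>)"

definition finite_type_invariant :: "('h, 'm) monoid_scheme \<Rightarrow> (word set \<Rightarrow> 'h) \<Rightarrow> bool" where
  "finite_type_invariant H v \<longleftrightarrow> homotopy_invariant H v \<and> (\<exists>n. vanishes_above H v n)"

definition ft_degree :: "('h, 'm) monoid_scheme \<Rightarrow> (word set \<Rightarrow> 'h) \<Rightarrow> nat" where
  "ft_degree H v = (LEAST n. vanishes_above H v n)"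

section \<open>The universal groups\<close>

definition iso_rel :: "word rel" where
  "iso_rel = {(u, w). gauss_word u \<and> gauss_word w \<and> isomorphic u w}"

definition iso_classes :: "word set set" where
  "iso_classes = {w. gauss_word w} // iso_rel"

definition gen :: "word \<Rightarrow> (word set \<Rightarrow>\<^sub>0 int)" where
  "gen w = frag_of (iso_rel `` {w})"

text \<open>In the second and third rule only the terms of maximal rank are required to be Gauss words;
  the other terms arise from these by deleting letters, so they are Gauss words as well.\<close>

inductive_set relators :: "nat \<Rightarrow> (word set \<Rightarrow>\<^sub>0 int) set" for n :: nat where
  R1: "gauss_word (x @ [A, A] @ y) \<Longrightarrow> gen (x @ [A, A] @ y) \<in> relators n"
| R2: "gauss_word (x @ [A, B] @ y @ [B, A] @ z) \<Longrightarrow>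
    gen (x @ [A, B] @ y @ [B, A] @ z) + gen (x @ [A] @ y @ [A] @ z) + gen (x @ [B] @ y @ [B] @ z)
      \<in> relators n"
| R3: "gauss_word (x @ [A, B] @ y @ [A, C] @ z @ [B, C] @ t) \<Longrightarrow>
    gauss_word (x @ [B, A] @ y @ [C, A] @ z @ [C, B] @ t) \<Longrightarrow>
    (gen (x @ [A, B] @ y @ [A, C] @ z @ [B, C] @ t)
      + gen (x @ [A, B] @ y @ [A] @ z @ [B] @ t)
      + gen (x @ [A] @ y @ [A, C] @ z @ [C] @ t)
      + gen (x @ [B] @ y @ [C] @ z @ [B, C] @ t))
    - (gen (x @ [B, A] @ y @ [C, A] @ z @ [C, B] @ t)
      + gen (x @ [B, A] @ y @ [A] @ z @ [B] @ t)
      + gen (x @ [A] @ y @ [C, A] @ z @ [C] @ t)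
      + gen (x @ [B] @ y @ [C] @ z @ [C, B] @ t))
      \<in> relators n"
| R4: "gauss_word p \<Longrightarrow> rank p > n \<Longrightarrow> gen p \<in> relators n"

definition universal_group :: "nat \<Rightarrow> (word set \<Rightarrow>\<^sub>0 int) set monoid" where
  "universal_group n =
    free_Abelian_group iso_classes Mod generate (free_Abelian_group iso_classes) (relators n)"

section \<open>The invariant \<open>v\<^sub>4\<close>\<close>

definition subword_count :: "word \<Rightarrow> word \<Rightarrow> nat" where
  "subword_count q w = card {S. S \<subseteq> set w \<and> isomorphic (delete_letters S w) q}"

text \<open>The words \<open>ABACDCBD\<close>, \<open>ABCACDBD\<close>, \<open>ABCADBDC\<close>, \<open>ABCBDACD\<close>, \<open>ABCDBDAC\<close>, \<open>ABCDCADB\<close>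
  with \<open>A, B, C, D = 1, 2, 3, 4\<close>.\<close>

definition v4_words :: "word list" where
  "v4_words =
    [[1,2,1,3,4,3,2,4],
     [1,2,3,1,3,4,2,4],
     [1,2,3,1,4,2,4,3],
     [1,2,3,2,4,1,3,4],
     [1,2,3,4,2,4,1,3],
     [1,2,3,4,3,1,4,2]]"

text \<open>The values \<open>0\<close> and \<open>1\<close> represent the elements of \<open>\<int>/2\<int>\<close>.\<close>

definition v4 :: "word \<Rightarrow> nat" where
  "v4 w = (\<Sum>q\<leftarrow>v4_words. subword_count q w) mod 2"

end

theory Submission
  imports Defs "HOL-Library.Multiset"
begin

text \<open>
  Everything follows from one computation: the subgroup of relations of degree \<open>4\<close> is the kernel of
  an explicit homomorphism from the free abelian group on Gauss words to
  \<open>\<int> \<oplus> \<int>/2\<int>\<close> (lemma \<open>kernel_coordinates\<close>). The first coordinate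
  is the coefficient of the empty word, the second is the parity of the total coefficient of the six words that
  define \<open>v\<^sub>4\<close>.

   The relators lie in the kernel because no relator involves the empty word and because each contains the six
  words an even number of times. For the first and second kind this holds since none of the six words contains
  \<open>AA\<close> or the pattern \<open>AB\<dots>BA\<close>, and since the two other terms of a relator of the
  second kind are isomorphic. A relator of the third kind only matters when its leading term has rank
  \<open>4\<close> or \<open>5\<close>, and up to renaming of letters there are few of these; they are checked
  one by one.

   Conversely, modulo relations every word is a combination of the empty word and of one of the six words, say
  \<open>g\<close>. Words of rank above \<open>4\<close> and words that contain \<open>AA\<close> vanish. A word
  of rank \<open>4\<close> is killed by \<open>2\<close>, because doubling one of its letters to
  \<open>AB\<dots>BA\<close> gives a relator of the second kind whose leading term has rank \<open>5\<close>.
  The remaining finitely many words are reached by propagation: once all terms of a relator but one are known to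
  be combinations of the two generators, so is the last term. A list of relators along which this works is given
  and run. Since \<open>2 * g\<close> is a relation, the kernel is no larger than the relations. This gives the
  structure of the universal group.

   For the second claim, let \<open>v\<close> be an invariant that vanishes on words with more than
  \<open>4\<close> semi-letters. Evaluating \<open>v\<close> on words with all letters marked respects the
  relators, since the alternating sums reduce each of them to the two sides of a homotopy move. So it gives a
  homomorphism that kills the relations. By Moebius inversion \<open>v(w)\<close> is the value of this
  homomorphism on the sum of all subwords of \<open>w\<close>. The coordinates of this sum are \<open>1\<close>
  and \<open>v\<^sub>4(w)\<close>, so words with the same \<open>v\<^sub>4\<close> have subword sums that differ
  by a relation, and \<open>v\<close> takes the same value on both.
\<close>

section \<open>Normal forms of Gauss words\<close>

text \<open>Each letter is replaced by the position of its first occurrence. This is a complete invariant of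
  isomorphism, and it can be computed.\<close>

definition normal_form :: "word \<Rightarrow> word" where
  "normal_form w = map (\<lambda>a. length (takeWhile (\<lambda>b. b \<noteq> a) w)) w"

lemma length_normal_form [simp]: "length (normal_form w) = length w"
  by (simp add: normal_form_def)

lemma normal_form_map:
  assumes "inj_on f (set w)"
  shows "normal_form (map f w) = normal_form w"
proof -
  have "takeWhile ((\<lambda>b. b \<noteq> f a) \<circ> f) w = takeWhile (\<lambda>b. b \<noteq> a) w" if "a \<in> set w" for a
    using assms that by (intro takeWhile_cong) (auto dest: inj_onD)
  then show ?thesis
    by (auto simp: normal_form_def takeWhile_map)
qed

lemma map_nth_normal_form: "map ((!) w) (normal_form w) = w"
proof -
  have "w ! length (takeWhile (\<lambda>b. b \<noteq> a) w) = a" if "a \<in> set w" for a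
    using nth_length_takeWhile[of "\<lambda>b. b \<noteq> a" w] that
    by (metis (mono_tags, lifting) takeWhile_eq_all_conv length_takeWhile_le le_neq_implies_less takeWhile_eq_take take_all le_refl)
  then show ?thesis
    by (simp add: normal_form_def map_idI)
qed

lemma isomorphic_map_iff: "isomorphic u w \<longleftrightarrow> (\<exists>f. inj_on f (set u) \<and> w = map f u)"
  by (auto simp: isomorphic_def bij_betw_def)

text \<open>A word is recovered from its normal form by looking up positions in the word itself. For two words
  with the same normal form this gives letter maps in both directions, each inverse to the other.\<close>

lemma isomorphic_iff_normal_form: "isomorphic u w \<longleftrightarrow> normal_form u = normal_form w"
proof
  assume "isomorphic u w"
  then show "normal_form u = normal_form w"
    by (auto simp: isomorphic_map_iff normal_form_map)
next
  assume eq: "normal_form u = normal_form w"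
  define f where "f = (\<lambda>a. w ! length (takeWhile (\<lambda>b. b \<noteq> a) u))"
  define g where "g = (\<lambda>a. u ! length (takeWhile (\<lambda>b. b \<noteq> a) w))"
  have w: "map f u = w"
    using map_nth_normal_form[of w] by (simp add: eq[symmetric]) (simp add: f_def normal_form_def comp_def)
  have "map g w = u"
    using map_nth_normal_form[of u] by (simp add: eq) (simp add: g_def normal_form_def comp_def)
  then have "map (g \<circ> f) u = u"
    by (simp add: w flip: map_map)
  then have "g (f a) = a" if "a \<in> set u" for a
    using that by (metis comp_apply map_eq_conv map_ident)
  then have "inj_on f (set u)"
    by (metis inj_onI)
  with w show "isomorphic u w"
    by (auto simp: isomorphic_map_iff)
qed

lemma nth_first_occurrence:
  fixes w :: word
  shows "a \<in> set w \<Longrightarrow> w ! length (takeWhile (\<lambda>b. b \<noteq> a) w) = a"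
  using map_nth_normal_form[of w] by (simp add: normal_form_def comp_def list_eq_iff_nth_eq) (metis in_set_conv_nth)

lemma isomorphic_normal_form: "isomorphic w (normal_form w)"
proof -
  have "inj_on ((!) w) (set (normal_form w))"
    by (rule inj_onI) (auto simp: normal_form_def nth_first_occurrence)
  then show ?thesis
    by (metis isomorphic_iff_normal_form map_nth_normal_form normal_form_map)
qed

lemma gauss_word_map:
  assumes "inj_on f (set w)"
  shows "gauss_word (map f w) \<longleftrightarrow> gauss_word w"
proof -
  have "count_list (map f w) (f a) = count_list w a" if "a \<in> set w" for a
  proof -
    have "f b = f a \<longleftrightarrow> b = a" if "b \<in> set w" for b
      using assms that \<open>a \<in> set w\<close> by (auto dest: inj_onD)
    then show ?thesis
      by (induction w) auto
  qed
  then show ?thesis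
    by (auto simp: gauss_word_def)
qed

lemma gauss_word_isomorphic: "isomorphic u w \<Longrightarrow> gauss_word u \<longleftrightarrow> gauss_word w"
  by (auto simp: isomorphic_map_iff gauss_word_map)

lemma gauss_word_normal_form: "gauss_word (normal_form w) \<longleftrightarrow> gauss_word w"
  by (metis gauss_word_isomorphic isomorphic_normal_form)

lemma gauss_word_Nil [simp]: "gauss_word []"
  by (simp add: gauss_word_def)

text \<open>Together with the next lemma: a nonempty Gauss word is a smaller one with a chord added.\<close>

lemma gauss_word_insert:
  "gauss_word (x @ A # y @ A # z) \<longleftrightarrow> A \<notin> set (x @ y @ z) \<and> gauss_word (x @ y @ z)"
proof -
  have "count_list (x @ A # y @ A # z) a = count_list (x @ y @ z) a + (if a = A then 2 else 0)" for a
    by simp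
  moreover have "A \<notin> set (x @ y @ z) \<longleftrightarrow> count_list (x @ y @ z) A = 0"
    by (simp add: count_list_0_iff)
  ultimately show ?thesis
    by (auto simp: gauss_word_def)
qed

lemma gauss_word_split:
  assumes "gauss_word w" "A \<in> set w"
  obtains x y z where "w = x @ A # y @ A # z" "A \<notin> set (x @ y @ z)" "gauss_word (x @ y @ z)"
proof -
  from assms obtain x w' where w: "w = x @ A # w'" "A \<notin> set x"
    by (meson split_list_first)
  have "count_list w A = 2"
    using assms by (simp add: gauss_word_def)
  then have "A \<in> set w'"
    using w by (metis count_list_append count_list.simps(2) count_notin add_0 add_0_right One_nat_def
        n_not_Suc_n numeral_2_eq_2)
  then obtain y z where "w' = y @ A # z"
    by (meson split_list)
  then show ?thesis
    using that[of x y z] assms(1) w gauss_word_insert[of x A y z] by simp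
qed

lemma length_gauss_word: "gauss_word w \<Longrightarrow> length w = 2 * rank w"
  using sum_count_set[of w "set w"] by (simp add: gauss_word_def rank_def)

lemma gauss_word_delete_letters: "gauss_word w \<Longrightarrow> gauss_word (delete_letters S w)"
proof -
  have "count_list (filter P w) a = (if P a then count_list w a else 0)" for a P
    by (induction w) auto
  then show "gauss_word w \<Longrightarrow> gauss_word (delete_letters S w)"
    by (auto simp: gauss_word_def delete_letters_def)
qed

text \<open>A Gauss word of rank \<open>n + 1\<close> is one of rank \<open>n\<close> with a chord added whose
  first end stands in front. The letters start at \<open>3\<close>, which leaves \<open>0\<close>,
  \<open>1\<close> and \<open>2\<close> for the letters that take part in a move.\<close>

fun chord_words :: "nat \<Rightarrow> word list" where
  "chord_words 0 = [[]]"
| "chord_words (Suc n) =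
    [(n + 3) # take i c @ (n + 3) # drop i c. c \<leftarrow> chord_words n, i \<leftarrow> [0..<2 * n + 1]]"

lemma chord_words_complete:
  assumes "gauss_word w" "length w = 2 * n"
  shows "\<exists>f. inj_on f (set w) \<and> f ` set w \<subseteq> {3..<n + 3} \<and> map f w \<in> set (chord_words n)"
  using assms
proof (induction n arbitrary: w)
  case 0
  then show ?case by simp
next
  case (Suc n)
  then obtain A u v where w: "w = A # u @ A # v"
    and A: "A \<notin> set (u @ v)" and uv: "gauss_word (u @ v)"
  proof -
    obtain A w' where w': "w = A # w'"
      using Suc.prems by (cases w) auto
    then obtain x y z where "w = x @ A # y @ A # z" "A \<notin> set (x @ y @ z)" "gauss_word (x @ y @ z)"
      using gauss_word_split[of w A] Suc.prems by auto
    moreover from this w' have "x = []"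
      by (cases x) auto
    ultimately show ?thesis
      using that by auto
  qed
  have "length (u @ v) = 2 * n"
    using Suc.prems w by simp
  with Suc.IH uv obtain f where f: "inj_on f (set (u @ v))" "f ` set (u @ v) \<subseteq> {3..<n + 3}"
    "map f (u @ v) \<in> set (chord_words n)"
    by blast
  let ?f = "f(A := n + 3)"
  have eq: "map ?f u = map f u" "map ?f v = map f v"
    using A by auto
  have "inj_on ?f (set w)"
    using f(1,2) A w by (auto simp: inj_on_def)
  moreover have "?f ` set w \<subseteq> {3..<Suc n + 3}"
    using f(2) A w by (fastforce simp: image_subset_iff)
  moreover have "map ?f w \<in> set (chord_words (Suc n))"
    using f(3) \<open>length (u @ v) = 2 * n\<close>
    by (auto simp: w eq simp del: upt_Suc intro!: bexI[of _ "map f (u @ v)"] image_eqI[of _ _ "length u"])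
  ultimately show ?case by blast
qed

section \<open>Relators\<close>

text \<open>Being a Gauss word depends on the multiset of letters only. This reduces the terms of a relator to
  one common shape.\<close>

lemma gauss_word_perm: "mset u = mset w \<Longrightarrow> gauss_word u \<longleftrightarrow> gauss_word w"
  by (metis count_mset gauss_word_def mset_eq_setD)

lemma gauss_word_Cons_Cons: "gauss_word (A # A # w) \<longleftrightarrow> A \<notin> set w \<and> gauss_word w"
  using gauss_word_insert[of "[]" A "[]" w] by simp

lemma gauss_word_Move2:
  "gauss_word (x @ [A, B] @ y @ [B, A] @ z) \<longleftrightarrow> gauss_word (A # A # B # B # x @ y @ z)"
  "gauss_word (x @ [A] @ y @ [A] @ z) \<longleftrightarrow> gauss_word (A # A # x @ y @ z)"
  by (rule gauss_word_perm, simp)+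

lemma gauss_word_Move3:
  "gauss_word (x @ [A, B] @ y @ [A, C] @ z @ [B, C] @ t) \<longleftrightarrow> gauss_word (A # A # B # B # C # C # x @ y @ z @ t)"
  "gauss_word (x @ [A, B] @ y @ [A] @ z @ [B] @ t) \<longleftrightarrow> gauss_word (A # A # B # B # x @ y @ z @ t)"
  "gauss_word (x @ [A] @ y @ [A, C] @ z @ [C] @ t) \<longleftrightarrow> gauss_word (A # A # C # C # x @ y @ z @ t)"
  "gauss_word (x @ [B] @ y @ [C] @ z @ [B, C] @ t) \<longleftrightarrow> gauss_word (B # B # C # C # x @ y @ z @ t)"
  "gauss_word (x @ [B, A] @ y @ [C, A] @ z @ [C, B] @ t) \<longleftrightarrow> gauss_word (A # A # B # B # C # C # x @ y @ z @ t)"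
  "gauss_word (x @ [B, A] @ y @ [A] @ z @ [B] @ t) \<longleftrightarrow> gauss_word (A # A # B # B # x @ y @ z @ t)"
  "gauss_word (x @ [A] @ y @ [C, A] @ z @ [C] @ t) \<longleftrightarrow> gauss_word (A # A # C # C # x @ y @ z @ t)"
  "gauss_word (x @ [B] @ y @ [C] @ z @ [C, B] @ t) \<longleftrightarrow> gauss_word (B # B # C # C # x @ y @ z @ t)"
  by (rule gauss_word_perm, simp add: ac_simps)+

abbreviation word_group :: "(word set \<Rightarrow>\<^sub>0 int) monoid" where
  "word_group \<equiv> free_Abelian_group iso_classes"

abbreviation relations :: "nat \<Rightarrow> (word set \<Rightarrow>\<^sub>0 int) set" where
  "relations n \<equiv> generate word_group (relators n)"

lemma iso_class_eq:
  assumes "gauss_word w"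
  shows "iso_rel `` {w} = {u. normal_form u = normal_form w}"
proof -
  have "iso_rel `` {w} = {u. gauss_word u \<and> isomorphic w u}"
    by (simp add: iso_rel_def Image_def assms)
  also have "\<dots> = {u. isomorphic w u}"
    using gauss_word_isomorphic assms by blast
  finally show ?thesis
    by (simp add: isomorphic_iff_normal_form eq_commute)
qed

lemma iso_class_eq_iff:
  "gauss_word u \<Longrightarrow> gauss_word w \<Longrightarrow>
    iso_rel `` {u} = iso_rel `` {w} \<longleftrightarrow> normal_form u = normal_form w"
  by (simp add: iso_class_eq) (metis (mono_tags) mem_Collect_eq)

lemma iso_class_in_iso_classes: "gauss_word w \<Longrightarrow> iso_rel `` {w} \<in> iso_classes"
  by (auto simp: iso_classes_def intro: quotientI)

lemma keys_gen: "gauss_word w \<Longrightarrow> Poly_Mapping.keys (gen w) \<subseteq> iso_classes"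
  by (simp add: gen_def iso_class_in_iso_classes)

lemma gen_cong:
  assumes "gauss_word u" "isomorphic u w"
  shows "gen u = gen w"
proof -
  have "gauss_word w"
    using assms gauss_word_isomorphic by blast
  then show ?thesis
    using assms by (simp add: gen_def iso_class_eq isomorphic_iff_normal_form)
qed

lemma gen_map: "gauss_word w \<Longrightarrow> inj_on f (set w) \<Longrightarrow> gen (map f w) = gen w"
  by (metis gen_cong isomorphic_map_iff)

lemma gen_normal_form: "gauss_word w \<Longrightarrow> gen (normal_form w) = gen w"
  by (metis gen_cong isomorphic_normal_form)

lemma keys_add_subset:
  "Poly_Mapping.keys p \<subseteq> S \<Longrightarrow> Poly_Mapping.keys q \<subseteq> S \<Longrightarrow> Poly_Mapping.keys (p + q) \<subseteq> S"
  by (meson Un_least keys_add order_trans)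

lemma keys_diff_subset:
  fixes p q :: "'a \<Rightarrow>\<^sub>0 int"
  shows "Poly_Mapping.keys p \<subseteq> S \<Longrightarrow> Poly_Mapping.keys q \<subseteq> S \<Longrightarrow> Poly_Mapping.keys (p - q) \<subseteq> S"
  by (meson Un_least keys_diff order_trans)

lemma keys_relator: "p \<in> relators n \<Longrightarrow> Poly_Mapping.keys p \<subseteq> iso_classes"
proof (induction rule: relators.induct)
  case (R2 x A B y z)
  then show ?case
    unfolding gauss_word_Move2
    by (intro keys_add_subset keys_gen) (simp_all add: gauss_word_Move2 gauss_word_Cons_Cons del: append.simps)
next
  case (R3 x A B y C z t)
  then show ?case
    unfolding gauss_word_Move3
    by (intro keys_add_subset keys_diff_subset keys_gen) (simp_all add: gauss_word_Move3 gauss_word_Cons_Cons del: append.simps)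
qed (simp_all add: keys_gen)

lemma relators_subset: "relators n \<subseteq> carrier word_group"
  using keys_relator by auto

lemma subgroup_relations: "subgroup (relations n) word_group"
  by (rule group.generate_is_subgroup[OF group_free_Abelian_group relators_subset])

lemma keys_relations: "p \<in> relations n \<Longrightarrow> Poly_Mapping.keys p \<subseteq> iso_classes"
  by (metis carrier_free_Abelian_group_iff subgroup.mem_carrier subgroup_relations)

lemma relations_zero: "0 \<in> relations n"
  using subgroup.one_closed[OF subgroup_relations] by simp

lemma relations_add: "p \<in> relations n \<Longrightarrow> q \<in> relations n \<Longrightarrow> p + q \<in> relations n"
  using subgroup.m_closed[OF subgroup_relations] by simp

lemma relations_uminus: "p \<in> relations n \<Longrightarrow> - p \<in> relations n"
  using subgroup.m_inv_closed[OF subgroup_relations] keys_relations by fastforce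

lemma relations_diff: "p \<in> relations n \<Longrightarrow> q \<in> relations n \<Longrightarrow> p - q \<in> relations n"
  using relations_add[of p n "- q"] by (simp add: relations_uminus)

lemma relations_cmul: "p \<in> relations n \<Longrightarrow> frag_cmul c p \<in> relations n"
proof (induction c rule: int_induct[of _ 0])
  case base
  show ?case by (simp add: relations_zero)
next
  case (step1 i)
  then show ?case by (simp add: frag_cmul_distrib relations_add)
next
  case (step2 i)
  then show ?case by (simp add: frag_cmul_diff_distrib relations_diff)
qed

lemma relator_relations: "p \<in> relators n \<Longrightarrow> p \<in> relations n"
  by (rule generate.incl)

lemma gen_not_distinct_adj:
  assumes "gauss_word w" "\<not> distinct_adj w"
  shows "gen w \<in> relations n"
proof -
  obtain i where "Suc i < length w" "w ! i = w ! Suc i"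
    using assms(2) by (auto simp: distinct_adj_conv_nth)
  then have "w = take i w @ [w ! i, w ! i] @ drop (Suc (Suc i)) w"
    by (metis Cons_nth_drop_Suc Suc_lessD append_Cons append_Nil append_take_drop_id)
  then show ?thesis
    by (metis assms(1) relators.R1 relator_relations)
qed

text \<open>This identifies the last two terms of the second relator.\<close>

lemma gen_rename:
  assumes "gauss_word (x @ [A] @ y @ [A] @ z)" "B \<notin> set (x @ y @ z)"
  shows "gen (x @ [A] @ y @ [A] @ z) = gen (x @ [B] @ y @ [B] @ z)"
proof (rule gen_cong[OF assms(1)])
  have "A \<notin> set (x @ y @ z)"
    using assms(1) unfolding gauss_word_Move2 by (simp add: gauss_word_Cons_Cons)
  then have "map (id(A := B)) (x @ [A] @ y @ [A] @ z) = x @ [B] @ y @ [B] @ z"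
    by (simp add: map_idI)
  moreover have "inj_on (id(A := B)) (set (x @ [A] @ y @ [A] @ z))"
    using assms(2) by (auto simp: inj_on_def)
  ultimately show "isomorphic (x @ [A] @ y @ [A] @ z) (x @ [B] @ y @ [B] @ z)"
    by (metis isomorphic_map_iff)
qed

text \<open>Add to \<open>w = xAyAz\<close> a letter \<open>B\<close> parallel to \<open>A\<close>. The second
  relator for \<open>xAByBAz\<close> has a leading term of rank \<open>n + 1\<close>, which the truncation
  kills, and its two other terms are both isomorphic to \<open>w\<close>.\<close>

lemma twice_gen:
  assumes "gauss_word w" "w \<noteq> []" "rank w = n"
  shows "frag_cmul 2 (gen w) \<in> relations n"
proof -
  from assms(2) obtain A where "A \<in> set w"
    by (meson list.set_sel(1))
  with assms(1) obtain x y z where w: "w = x @ [A] @ y @ [A] @ z"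
    using gauss_word_split by (metis append_Cons append_Nil)
  obtain B where B: "B \<notin> set w"
    using ex_new_if_finite[OF infinite_UNIV_nat finite_set] by blast
  let ?p = "x @ [A, B] @ y @ [B, A] @ z" and ?w = "x @ [B] @ y @ [B] @ z"
  have p: "gauss_word ?p"
    using assms(1) B unfolding w gauss_word_Move2 by (simp add: gauss_word_Cons_Cons)
  have "rank ?p > n"
    using length_gauss_word[OF p] length_gauss_word[OF assms(1)] assms(3) w by simp
  have "gen w = gen ?w"
    using assms(1) B gen_rename[of x A y z B] by (simp add: w)
  then have eq: "frag_cmul 2 (gen w) = (gen ?p + gen w + gen ?w) - gen ?p"
    using frag_cmul_distrib[of 1 1 "gen w"] by simp
  moreover have "gen ?p + gen w + gen ?w \<in> relators n"
    unfolding w by (rule relators.R2[OF p])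
  moreover have "gen ?p \<in> relators n"
    by (rule relators.R4) fact+
  ultimately show ?thesis
    unfolding eq by (intro relations_diff relator_relations)
qed

text \<open>Relators of the second and third kind as data, so that they can be listed and computed with.\<close>

datatype move = Move2 nat nat word word word | Move3 nat nat nat word word word word

fun terms :: "move \<Rightarrow> (int \<times> word) list" where
  "terms (Move2 A B x y z) =
    [(1, x @ [A, B] @ y @ [B, A] @ z), (1, x @ [A] @ y @ [A] @ z), (1, x @ [B] @ y @ [B] @ z)]"
| "terms (Move3 A B C x y z t) =
    [(1, x @ [A, B] @ y @ [A, C] @ z @ [B, C] @ t),
     (1, x @ [A, B] @ y @ [A] @ z @ [B] @ t),
     (1, x @ [A] @ y @ [A, C] @ z @ [C] @ t),
     (1, x @ [B] @ y @ [C] @ z @ [B, C] @ t),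
     (-1, x @ [B, A] @ y @ [C, A] @ z @ [C, B] @ t),
     (-1, x @ [B, A] @ y @ [A] @ z @ [B] @ t),
     (-1, x @ [A] @ y @ [C, A] @ z @ [C] @ t),
     (-1, x @ [B] @ y @ [C] @ z @ [C, B] @ t)]"

definition admissible :: "move \<Rightarrow> bool" where
  "admissible I \<longleftrightarrow> list_all (\<lambda>(c, w). gauss_word w) (terms I)"

lemma admissible_Move2: "admissible (Move2 A B x y z) \<longleftrightarrow> gauss_word (A # A # B # B # x @ y @ z)"
  by (auto simp: admissible_def gauss_word_Move2 gauss_word_Cons_Cons simp del: append.simps)

lemma admissible_Move3:
  "admissible (Move3 A B C x y z t) \<longleftrightarrow> gauss_word (A # A # B # B # C # C # x @ y @ z @ t)"
  by (auto simp: admissible_def gauss_word_Move3 gauss_word_Cons_Cons simp del: append.simps)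

lemma admissible_gauss_word: "admissible I \<Longrightarrow> \<forall>(c, w) \<in> set (terms I). gauss_word w"
  by (simp add: admissible_def list_all_iff)

definition lincomb :: "(int \<times> word) list \<Rightarrow> (word set \<Rightarrow>\<^sub>0 int)" where
  "lincomb ts = (\<Sum>(c, w)\<leftarrow>ts. frag_cmul c (gen w))"

lemma lincomb_map:
  assumes "inj_on f X" "\<forall>(c, w) \<in> set ts. gauss_word w \<and> set w \<subseteq> X"
  shows "lincomb (map (map_prod id (map f)) ts) = lincomb ts"
  using assms(2)
proof (induction ts)
  case (Cons s ts)
  then have "gen (map f (snd s)) = gen (snd s)"
    by (intro gen_map inj_on_subset[OF assms(1)]) auto
  with Cons show ?case
    by (cases s) (simp add: lincomb_def)
qed simp

lemma relators_cases [consumes 1, case_names R1 move R4]: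
  assumes "p \<in> relators n"
  obtains x A y where "p = gen (x @ [A, A] @ y)" "gauss_word (x @ [A, A] @ y)"
  | I where "p = lincomb (terms I)" "admissible I"
  | w where "p = gen w" "gauss_word w" "rank w > n"
  using assms
proof cases
  case (R2 x A B y z)
  then show ?thesis
    using that(2)[of "Move2 A B x y z"] unfolding gauss_word_Move2 admissible_Move2
    by (simp add: lincomb_def add.assoc)
next
  case (R3 x A B y C z t)
  then show ?thesis
    using that(2)[of "Move3 A B C x y z t"] unfolding gauss_word_Move3 admissible_Move3
    by (simp add: lincomb_def algebra_simps)
qed (use that in blast)+

lemma lincomb_terms: "admissible I \<Longrightarrow> lincomb (terms I) \<in> relations n"
proof (cases I)
  case (Move2 A B x y z)
  assume "admissible I"
  then show ?thesis
    using relator_relations[OF relators.R2, of x A B y z n] unfolding gauss_word_Move2 Move2 admissible_Move2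
    by (simp add: lincomb_def add.assoc)
next
  case (Move3 A B C x y z t)
  assume "admissible I"
  then show ?thesis
    using relator_relations[OF relators.R3, of x A B y C z t n] unfolding gauss_word_Move3 Move3 admissible_Move3
    by (simp add: lincomb_def algebra_simps)
qed

section \<open>The two coordinates of the universal group\<close>

text \<open>By lemma \<open>special_iff_isomorphic\<close>: isomorphic to one of the six words in
  \<open>v\<^sub>4\<close>. Comparing normal forms makes this executable.\<close>

definition special :: "word \<Rightarrow> bool" where
  "special w \<longleftrightarrow> normal_form w \<in> set (map normal_form v4_words)"

lemma special_iff_isomorphic: "special w \<longleftrightarrow> (\<exists>q \<in> set v4_words. isomorphic w q)"
  by (auto simp: special_def isomorphic_iff_normal_form)

lemma gauss_word_v4_words: "list_all gauss_word v4_words"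
  by code_simp

lemma distinct_normal_form_v4_words: "distinct (map normal_form v4_words)"
  by code_simp

lemma special_length: "special w \<Longrightarrow> length w = 8"
proof -
  have "list_all (\<lambda>q. length q = 8) v4_words" by code_simp
  then show "special w \<Longrightarrow> length w = 8"
    by (auto simp: special_def list_all_iff) (metis length_normal_form)
qed

lemma v4_words_distinct_adj: "list_all distinct_adj v4_words"
  by code_simp

lemma special_imp_distinct_adj: "special w \<Longrightarrow> distinct_adj w"
  using v4_words_distinct_adj by (auto simp: special_iff_isomorphic isomorphic_map_iff list_all_iff distinct_adj_map_iff)

text \<open>The indices \<open>i\<close> and \<open>j\<close> are the positions of \<open>AB\<close> and
  \<open>BA\<close> in \<open>xAByBAz\<close>.\<close>

lemma v4_words_no_Move2_pattern:
  "list_all (\<lambda>q. list_all (\<lambda>i. list_all (\<lambda>j. \<not> (q ! i = q ! Suc j \<and> q ! Suc i = q ! j)) [i+2..<7]) [0..<5]) v4_words"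
  by code_simp

lemma not_special_Move2: "\<not> special (x @ [A, B] @ y @ [B, A] @ z)"
proof
  let ?w = "x @ [A, B] @ y @ [B, A] @ z" and ?i = "length x" and ?j = "length x + length y + 2"
  assume w: "special ?w"
  then obtain f where f: "map f ?w \<in> set v4_words"
    by (auto simp: special_iff_isomorphic isomorphic_map_iff)
  have "length x + length y + length z = 4"
    using special_length[OF w] by simp
  then have "?i \<in> set [0..<5]" "?j \<in> set [?i + 2..<7]"
    by auto
  then have "\<not> (map f ?w ! ?i = map f ?w ! Suc ?j \<and> map f ?w ! Suc ?i = map f ?w ! ?j)"
    using v4_words_no_Move2_pattern f unfolding list_all_iff by blast
  moreover have "map f ?w ! ?i = f A" "map f ?w ! Suc ?i = f B"
    "map f ?w ! ?j = f B" "map f ?w ! Suc ?j = f A"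
    by (simp_all add: nth_append)
  ultimately show False by simp
qed

definition constant_part :: "(word set \<Rightarrow>\<^sub>0 int) \<Rightarrow> int" where
  "constant_part p = Poly_Mapping.lookup p (iso_rel `` {[]})"

definition weight :: "(word set \<Rightarrow>\<^sub>0 int) \<Rightarrow> int" where
  "weight p = (\<Sum>q\<leftarrow>v4_words. Poly_Mapping.lookup p (iso_rel `` {q}))"

lemma constant_part_linear [simp]:
  "constant_part 0 = 0"
  "constant_part (p + q) = constant_part p + constant_part q"
  "constant_part (p - q) = constant_part p - constant_part q"
  "constant_part (frag_cmul c p) = c * constant_part p"
  by (simp_all add: constant_part_def lookup_add lookup_minus)

lemma weight_linear [simp]:
  "weight 0 = 0"
  "weight (p + q) = weight p + weight q"
  "weight (p - q) = weight p - weight q"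
  "weight (frag_cmul c p) = c * weight p"
  by (simp_all add: weight_def lookup_add lookup_minus sum_list_addf sum_list_subtractf sum_list_const_mult)

lemma lookup_gen:
  "gauss_word u \<Longrightarrow> gauss_word w \<Longrightarrow>
    Poly_Mapping.lookup (gen w) (iso_rel `` {u}) = of_bool (isomorphic w u)"
  by (auto simp: gen_def iso_class_eq_iff isomorphic_iff_normal_form)

lemma constant_part_gen: "gauss_word w \<Longrightarrow> constant_part (gen w) = of_bool (w = [])"
  by (auto simp: constant_part_def lookup_gen isomorphic_map_iff)

text \<open>The six words of \<open>v\<^sub>4\<close> are pairwise not isomorphic, so at most one of the six
  coefficients counts.\<close>

lemma weight_gen:
  assumes "gauss_word w"
  shows "weight (gen w) = of_bool (special w)"
proof -
  have "weight (gen w) = (\<Sum>q\<leftarrow>v4_words. of_bool (normal_form w = normal_form q))"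
    using gauss_word_v4_words assms
    by (auto simp: weight_def lookup_gen isomorphic_iff_normal_form list_all_iff intro!: arg_cong[of _ _ sum_list])
  also have "\<dots> = (\<Sum>u\<leftarrow>map normal_form v4_words. of_bool (normal_form w = u))"
    by (simp add: comp_def)
  also have "\<dots> = (\<Sum>u\<in>set (map normal_form v4_words). of_bool (normal_form w = u))"
    using distinct_normal_form_v4_words by (rule sum_list_distinct_conv_sum_set)
  also have "\<dots> = of_bool (special w)"
    by (simp add: special_def of_bool_def)
  finally show ?thesis .
qed

definition signed_count :: "(int \<times> word) list \<Rightarrow> int" where
  "signed_count ts = (\<Sum>(c, w)\<leftarrow>ts. if special w then c else 0)"

lemma weight_lincomb:
  "\<forall>(c, w) \<in> set ts. gauss_word w \<Longrightarrow> weight (lincomb ts) = signed_count ts"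
  by (induction ts) (auto simp: lincomb_def signed_count_def weight_gen)

definition splits :: "word \<Rightarrow> (word \<times> word) list" where
  "splits u = map (\<lambda>i. (take i u, drop i u)) [0..<Suc (length u)]"

lemma splits_append: "(u, v) \<in> set (splits (u @ v))"
  by (auto simp: splits_def intro!: image_eqI[of _ _ "length u"])

text \<open>All ways to insert \<open>AB\<close>, \<open>AC\<close> and \<open>BC\<close> into a Gauss word, up
  to renaming, when the leading term has rank at most \<open>5\<close>. In higher rank no term has rank
  \<open>4\<close>.\<close>

lemma Move3_even_weight:
  "list_all (\<lambda>k. list_all (\<lambda>u. list_all (\<lambda>(x, u'). list_all (\<lambda>(y, u''). list_all (\<lambda>(z, t).
     even (signed_count (terms (Move3 0 1 2 x y z t)))) (splits u'')) (splits u')) (splits u)) (chord_words k)) [0,1,2]"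
  by code_simp

text \<open>Injective renaming of letters does not change a generator. So the participating letters may be taken
  to be \<open>0\<close>, \<open>1\<close>, \<open>2\<close>, and the word formed by the others may be taken
  from the list of all Gauss words of its rank.\<close>

lemma Move3_canonical:
  assumes I: "admissible (Move3 A B C x y z t)"
  obtains x' y' z' t' where
    "admissible (Move3 0 1 2 x' y' z' t')"
    "x' @ y' @ z' @ t' \<in> set (chord_words (length (x @ y @ z @ t) div 2))"
    "length (x' @ y' @ z' @ t') = length (x @ y @ z @ t)"
    "lincomb (terms (Move3 0 1 2 x' y' z' t')) = lincomb (terms (Move3 A B C x y z t))"
proof -
  let ?u = "x @ y @ z @ t"
  have ABC: "distinct [A, B, C]" "{A, B, C} \<inter> set ?u = {}" and u: "gauss_word ?u"
    using I unfolding admissible_Move3 by (auto simp: gauss_word_Cons_Cons)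
  have "length ?u = 2 * (length ?u div 2)"
    unfolding length_gauss_word[OF u] by simp
  then obtain g where g: "inj_on g (set ?u)" "g ` set ?u \<subseteq> {3..<length ?u div 2 + 3}"
      "map g ?u \<in> set (chord_words (length ?u div 2))"
    using chord_words_complete[OF u] by blast
  define f where "f = g(A := 0, B := 1, C := 2)"
  have f: "f A = 0" "f B = 1" "f C = 2"
    using ABC by (auto simp: f_def)
  have fg: "f a = g a" if "a \<in> set ?u" for a
    using that ABC by (auto simp: f_def)
  let ?X = "{A, B, C} \<union> set ?u" and ?I = "Move3 0 1 2 (map f x) (map f y) (map f z) (map f t)"
  have inj: "inj_on f ?X"
  proof -
    have "inj_on f (set ?u)"
      using g(1) by (subst inj_on_cong[of _ f g]) (rule fg)
    moreover have "inj_on f {A, B, C}"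
      using f by (auto simp: inj_on_def)
    moreover have "f ` {A, B, C} \<inter> f ` set ?u = {}"
    proof -
      have "f ` set ?u = g ` set ?u"
        by (rule image_cong) (simp_all only: fg)
      then have "f ` set ?u \<subseteq> {3..<length ?u div 2 + 3}"
        using g(2) by (simp only:)
      moreover have "f ` {A, B, C} \<inter> {3..<length ?u div 2 + 3} = {}"
        using f by simp
      ultimately show ?thesis by blast
    qed
    ultimately show ?thesis
      unfolding inj_on_Un by blast
  qed
  define T where "T = terms (Move3 A B C x y z t)"
  have terms: "terms ?I = map (map_prod id (map f)) T"
    by (simp add: f T_def)
  have "\<forall>(c, w) \<in> set T. set w \<subseteq> ?X"
    by (auto simp: T_def)
  moreover have "\<forall>(c, w) \<in> set T. gauss_word w"
    unfolding T_def by (rule admissible_gauss_word[OF I])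
  ultimately have T: "\<forall>(c, w) \<in> set T. gauss_word w \<and> set w \<subseteq> ?X"
    by blast
  show ?thesis
  proof (rule that)
    have "gauss_word (map f w)" if "(c, w) \<in> set T" for c w
      using that T gauss_word_map inj_on_subset[OF inj] by blast
    then show "admissible ?I"
      unfolding admissible_def terms list_all_iff by auto
    have "map f ?u = map g ?u"
      unfolding map_eq_conv by (rule ballI) (rule fg)
    then show "map f x @ map f y @ map f z @ map f t \<in> set (chord_words (length ?u div 2))"
      using g(3) by (simp only: map_append)
    show "lincomb (terms ?I) = lincomb (terms (Move3 A B C x y z t))"
      unfolding terms using lincomb_map[OF inj T] by (simp only: T_def)
  qed simp
qed

lemma sum_list_eq_0: "(\<And>x. x \<in> set xs \<Longrightarrow> f x = 0) \<Longrightarrow> sum_list (map f xs) = (0 :: int)"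
  by (induction xs) auto

text \<open>The leading term \<open>xAByBAz\<close> of a second relator is never special, and the two others are
  isomorphic, hence count twice. A third relator is special in no term, or is covered by the finite check.\<close>

lemma even_signed_count_terms: "admissible I \<Longrightarrow> even (signed_count (terms I))"
proof (cases I)
  case (Move2 A B x y z)
  assume "admissible I"
  then have w: "gauss_word (x @ [A] @ y @ [A] @ z)" "gauss_word (x @ [B] @ y @ [B] @ z)" and "B \<notin> set (x @ y @ z)"
    unfolding Move2 admissible_Move2 gauss_word_Move2 by (auto simp: gauss_word_Cons_Cons)
  then have "gen (x @ [A] @ y @ [A] @ z) = gen (x @ [B] @ y @ [B] @ z)"
    by (intro gen_rename)
  then have "special (x @ [A] @ y @ [A] @ z) \<longleftrightarrow> special (x @ [B] @ y @ [B] @ z)"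
    using weight_gen[OF w(1)] weight_gen[OF w(2)] by (metis of_bool_eq_iff)
  then show ?thesis
    using not_special_Move2[of x A B y z] by (simp add: Move2 signed_count_def)
next
  case (Move3 A B C x y z t)
  assume "admissible I"
  then obtain x' y' z' t' where I: "admissible (Move3 0 1 2 x' y' z' t')"
    and mem: "x' @ y' @ z' @ t' \<in> set (chord_words (length (x @ y @ z @ t) div 2))"
    and len: "length (x' @ y' @ z' @ t') = length (x @ y @ z @ t)"
    and eq: "lincomb (terms (Move3 0 1 2 x' y' z' t')) = lincomb (terms I)"
    unfolding Move3 using Move3_canonical by blast
  have "even (signed_count (terms (Move3 0 1 2 x' y' z' t')))"
  proof (cases "length (x @ y @ z @ t) div 2 \<le> 2")
    case True
    then have "length (x @ y @ z @ t) div 2 \<in> set [0, 1, 2]"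
      by auto
    then show ?thesis
      using Move3_even_weight mem splits_append[of x' "y' @ z' @ t'"] splits_append[of y' "z' @ t'"]
        splits_append[of z' t'] unfolding list_all_iff by fastforce
  next
    case False
    then have "length w \<noteq> 8" if "(c, w) \<in> set (terms (Move3 0 1 2 x' y' z' t'))" for c w
      using that len by auto
    then have "\<not> special w" if "(c, w) \<in> set (terms (Move3 0 1 2 x' y' z' t'))" for c w
      using that special_length by metis
    then have "signed_count (terms (Move3 0 1 2 x' y' z' t')) = 0"
      unfolding signed_count_def by (intro sum_list_eq_0) (auto simp del: terms.simps)
    then show ?thesis by simp
  qed
  then show ?thesis
    using eq weight_lincomb[OF admissible_gauss_word[OF I]]
      weight_lincomb[OF admissible_gauss_word[OF \<open>admissible I\<close>]] by simp
qed

lemma relators_weight: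
  assumes "p \<in> relators 4"
  shows "even (weight p)"
  using assms
proof (cases rule: relators_cases)
  case (R1 x A y)
  have "\<not> distinct_adj (x @ [A, A] @ y)"
    by (simp add: distinct_adj_append_iff)
  with R1 show ?thesis
    by (auto simp: weight_gen special_imp_distinct_adj)
next
  case (move I)
  then show ?thesis
    using weight_lincomb[OF admissible_gauss_word] even_signed_count_terms by simp
next
  case (R4 w)
  then show ?thesis
    using special_length[of w] length_gauss_word[of w] by (auto simp: weight_gen)
qed

lemma constant_part_lincomb:
  "\<forall>(c, w) \<in> set ts. gauss_word w \<and> w \<noteq> [] \<Longrightarrow> constant_part (lincomb ts) = 0"
  by (induction ts) (auto simp: lincomb_def constant_part_gen)

lemma relators_constant_part:
  assumes "p \<in> relators n"
  shows "constant_part p = 0"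
  using assms
proof (cases rule: relators_cases)
  case (move I)
  have "\<forall>(c, w) \<in> set (terms I). w \<noteq> []"
    by (cases I) auto
  then show ?thesis
    using admissible_gauss_word[OF move(2)] unfolding move(1) by (intro constant_part_lincomb) blast
qed (auto simp: constant_part_gen rank_def)

text \<open>The isomorphism from the universal group of degree \<open>4\<close>, before passing to the quotient.\<close>

definition coordinates :: "(word set \<Rightarrow>\<^sub>0 int) \<Rightarrow> int \<times> int" where
  "coordinates p = (constant_part p, weight p mod 2)"

lemma coordinates_hom: "coordinates \<in> hom word_group (integer_group \<times>\<times> integer_mod_group 2)"
  by (rule homI) (auto simp: coordinates_def integer_mod_group_def integer_group_def DirProd_def mod_simps)

lemma group_hom_coordinates:
  "group_hom word_group (integer_group \<times>\<times> integer_mod_group 2) coordinates"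
  using coordinates_hom
  by (simp add: group_hom_def group_hom_axioms_def DirProd_group group_integer_group group_integer_mod_group)

lemma one_target: "\<one>\<^bsub>integer_group \<times>\<times> integer_mod_group 2\<^esub> = (0, 0)"
  by (simp add: integer_group_def)

lemma relations_subset_kernel:
  "relations 4 \<subseteq> kernel word_group (integer_group \<times>\<times> integer_mod_group 2) coordinates"
proof (rule group.generate_subgroup_incl[OF group_free_Abelian_group])
  show "relators 4 \<subseteq> kernel word_group (integer_group \<times>\<times> integer_mod_group 2) coordinates"
    using keys_relator relators_weight relators_constant_part
    by (auto simp: kernel_def one_target coordinates_def simp del: one_DirProd)
qed (rule group_hom.subgroup_kernel[OF group_hom_coordinates])

section \<open>Generation by two words\<close>

text \<open>The elements that are, modulo relations, combinations of the empty word and of one fixed special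
  word. By lemma \<open>in_span\<close> they make up the whole group.\<close>

definition span :: "(word set \<Rightarrow>\<^sub>0 int) set" where
  "span = {p. \<exists>a b. p - frag_cmul a (gen []) - frag_cmul b (gen (hd v4_words)) \<in> relations 4}"

lemma span_relations: "p \<in> relations 4 \<Longrightarrow> p \<in> span"
  by (auto simp: span_def intro!: exI[of _ 0])

lemma span_diff: "p \<in> span \<Longrightarrow> q \<in> span \<Longrightarrow> p - q \<in> span"
proof -
  assume "p \<in> span" "q \<in> span"
  then obtain a b a' b' where
    "p - frag_cmul a (gen []) - frag_cmul b (gen (hd v4_words)) \<in> relations 4"
    "q - frag_cmul a' (gen []) - frag_cmul b' (gen (hd v4_words)) \<in> relations 4"
    by (auto simp: span_def)
  from relations_diff[OF this]
  have "p - q - frag_cmul (a - a') (gen []) - frag_cmul (b - b') (gen (hd v4_words)) \<in> relations 4"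
    by (simp add: frag_cmul_diff_distrib algebra_simps)
  then show ?thesis
    unfolding span_def by blast
qed

lemma span_zero: "0 \<in> span"
  by (simp add: span_relations relations_zero)

lemma span_add: "p \<in> span \<Longrightarrow> q \<in> span \<Longrightarrow> p + q \<in> span"
  using span_diff[of p "0 - q"] span_diff[of 0 q] by (simp add: span_zero)

lemma span_cmul: "p \<in> span \<Longrightarrow> frag_cmul c p \<in> span"
proof (induction c rule: int_induct[of _ 0])
  case base
  show ?case by (simp add: span_zero)
next
  case (step1 i)
  then show ?case by (simp add: frag_cmul_distrib span_add)
next
  case (step2 i)
  then show ?case by (simp add: frag_cmul_diff_distrib span_diff)
qed

lemma gen_generators_in_span: "gen [] \<in> span" "gen (hd v4_words) \<in> span"
proof -
  have "gen [] - frag_cmul 1 (gen []) - frag_cmul 0 (gen (hd v4_words)) \<in> relations 4"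
    "gen (hd v4_words) - frag_cmul 0 (gen []) - frag_cmul 1 (gen (hd v4_words)) \<in> relations 4"
    by (simp_all add: relations_zero)
  then show "gen [] \<in> span" "gen (hd v4_words) \<in> span"
    unfolding span_def by blast+
qed

fun add_term :: "int \<times> word \<Rightarrow> (int \<times> word) list \<Rightarrow> (int \<times> word) list" where
  "add_term (c, w) [] = [(c, w)]"
| "add_term (c, w) ((d, u) # ts) =
    (if u = w then (c + d, u) # ts else (d, u) # add_term (c, w) ts)"

lemma lincomb_add_term: "lincomb (add_term (c, w) ts) = frag_cmul c (gen w) + lincomb ts"
  by (induction "(c, w)" ts rule: add_term.induct)
    (auto simp: lincomb_def frag_cmul_distrib algebra_simps)

lemma set_add_term: "snd ` set (add_term (c, w) ts) \<subseteq> insert w (snd ` set ts)"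
  by (induction "(c, w)" ts rule: add_term.induct) (auto simp: image_iff)

text \<open>The formal sum \<open>m * ts\<close> with isomorphic words merged; without this, terms that cancel
  would count as obstacles below.\<close>

fun collect :: "int \<Rightarrow> (int \<times> word) list \<Rightarrow> (int \<times> word) list" where
  "collect m [] = []"
| "collect m ((c, w) # ts) = add_term (m * c, normal_form w) (collect m ts)"

lemma lincomb_collect:
  "\<forall>(c, w) \<in> set ts. gauss_word w \<Longrightarrow> lincomb (collect m ts) = frag_cmul m (lincomb ts)"
proof (induction ts)
  case Nil
  then show ?case by (simp add: lincomb_def)
next
  case (Cons t ts)
  obtain c w where t: "t = (c, w)" by fastforce
  have "lincomb (collect m ts) = frag_cmul m (lincomb ts)" "gauss_word w"
    using Cons.IH Cons.prems by (simp_all add: t)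
  then have "lincomb (collect m (t # ts)) = frag_cmul (m * c) (gen w) + frag_cmul m (lincomb ts)"
    by (simp only: t collect.simps lincomb_add_term gen_normal_form)
  then show ?case
    by (simp add: t lincomb_def frag_cmul_distrib2)
qed

lemma set_collect: "snd ` set (collect m ts) \<subseteq> normal_form ` snd ` set ts"
proof (induction ts)
  case (Cons t ts)
  obtain c w where t: "t = (c, w)" by fastforce
  have "snd ` set (collect m (t # ts)) \<subseteq> insert (normal_form w) (snd ` set (collect m ts))"
    by (simp add: t set_add_term)
  also have "\<dots> \<subseteq> insert (normal_form w) (normal_form ` snd ` set ts)"
    using Cons by (rule insert_mono)
  finally show ?case
    by (simp add: t)
qed simp

text \<open>A sufficient condition for \<open>c * w\<close> to lie in the span. A fact \<open>(d, u)\<close>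
  records that \<open>d * u\<close> lies in the span; the other disjuncts come from the truncation, from lemma
  \<open>twice_gen\<close> and from the first relator.\<close>

definition reached :: "(int \<times> word) list \<Rightarrow> int \<times> word \<Rightarrow> bool" where
  "reached facts = (\<lambda>(c, w). c = 0 \<or> length w > 8 \<or> length w = 8 \<and> even c \<or> \<not> distinct_adj w \<or>
    list_ex (\<lambda>(d, u). u = w \<and> d dvd c) facts)"

text \<open>Relations among elements of the span propagate: if all terms of a multiple of a relator but one lie
  in the span, then so does the last one.\<close>

definition propagate :: "(int \<times> word) list \<Rightarrow> int \<times> move \<Rightarrow> (int \<times> word) list" where
  "propagate facts = (\<lambda>(m, I).
    (case filter (\<lambda>t. \<not> reached facts t) (collect m (terms I)) of
      [t] \<Rightarrow> if admissible I then t # facts else facts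
    | _ \<Rightarrow> facts))"

definition facts_hold :: "(int \<times> word) list \<Rightarrow> bool" where
  "facts_hold facts \<longleftrightarrow> (\<forall>(c, w) \<in> set facts. frag_cmul c (gen w) \<in> span)"

lemma reached_in_span:
  assumes "facts_hold facts" "gauss_word w" "reached facts (c, w)"
  shows "frag_cmul c (gen w) \<in> span"
proof -
  consider "c = 0" | "length w > 8" | "length w = 8" "even c" | "\<not> distinct_adj w"
    | d where "(d, w) \<in> set facts" "d dvd c"
    using assms(3) by (auto simp: reached_def list_ex_iff)
  then show ?thesis
  proof cases
    case 1
    then show ?thesis by (simp add: span_zero)
  next
    case 2
    with assms(2) have "gen w \<in> relators 4"
      by (intro relators.R4) (simp_all add: length_gauss_word)
    then show ?thesis
      by (simp add: span_cmul span_relations relator_relations)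
  next
    case 3
    then obtain k where "c = k * 2"
      by (auto elim: evenE)
    moreover have "frag_cmul 2 (gen w) \<in> relations 4"
      using 3(1) length_gauss_word[OF assms(2)] by (intro twice_gen[OF assms(2)]) auto
    ultimately show ?thesis
      by (metis frag_cmul_cmul span_cmul span_relations)
  next
    case 4
    with assms(2) show ?thesis
      by (simp add: gen_not_distinct_adj span_cmul span_relations)
  next
    case 5
    then have "frag_cmul d (gen w) \<in> span"
      using assms(1) by (auto simp: facts_hold_def)
    moreover obtain k where "c = k * d"
      using 5 by (metis dvdE mult.commute)
    ultimately show ?thesis
      by (metis frag_cmul_cmul span_cmul)
  qed
qed

lemma lincomb_filter:
  assumes "\<forall>t \<in> set ts. \<not> P t \<longrightarrow> frag_cmul (fst t) (gen (snd t)) \<in> span" "lincomb ts \<in> span"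
  shows "lincomb (filter P ts) \<in> span"
proof -
  have "\<exists>q \<in> span. lincomb ts = lincomb (filter P ts) + q"
    using assms(1)
  proof (induction ts)
    case Nil
    then show ?case by (simp add: lincomb_def span_zero)
  next
    case (Cons t ts)
    then obtain q where "q \<in> span" "lincomb ts = lincomb (filter P ts) + q" by auto
    with Cons.prems show ?case
      by (cases "P t")
        (auto simp: lincomb_def case_prod_beta add.assoc intro: bexI[of _ q]
          intro!: bexI[of _ "frag_cmul (fst t) (gen (snd t)) + q"] span_add)
  qed
  then show ?thesis
    using assms(2) span_diff by force
qed

lemma facts_hold_propagate:
  assumes "facts_hold facts"
  shows "facts_hold (propagate facts (m, I))"
proof (cases "\<exists>t. filter (\<lambda>t. \<not> reached facts t) (collect m (terms I)) = [t] \<and> admissible I")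
  case False
  then show ?thesis
    using assms by (auto simp: propagate_def split: list.splits)
next
  case True
  then obtain c w where t: "filter (\<lambda>t. \<not> reached facts t) (collect m (terms I)) = [(c, w)]"
    and I: "admissible I" by auto
  have terms: "\<forall>(c, w) \<in> set (terms I). gauss_word w"
    by (rule admissible_gauss_word[OF I])
  have "lincomb (collect m (terms I)) \<in> span"
    unfolding lincomb_collect[OF terms] using I by (intro span_cmul span_relations lincomb_terms)
  moreover have "frag_cmul (fst t) (gen (snd t)) \<in> span"
    if "t \<in> set (collect m (terms I))" "\<not> \<not> reached facts t" for t
  proof -
    have "snd t \<in> normal_form ` snd ` set (terms I)"
      using that(1) set_collect by blast
    then have "gauss_word (snd t)"
      using terms by (auto simp: gauss_word_normal_form)
    with that(2) show ?thesis
      using reached_in_span[OF assms, of "snd t" "fst t"] by simp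
  qed
  ultimately have "lincomb [(c, w)] \<in> span"
    using lincomb_filter[of "collect m (terms I)" "\<lambda>t. \<not> reached facts t"] t by simp
  then show ?thesis
    using assms t I by (auto simp: propagate_def facts_hold_def lincomb_def)
qed

lemma facts_hold_foldl: "facts_hold facts \<Longrightarrow> facts_hold (foldl propagate facts ms)"
  by (induction ms arbitrary: facts) (auto intro: facts_hold_propagate)

text \<open>A sequence of relators, each with the factor by which it is multiplied, such that at its turn
  exactly one term has not been reached yet. Starting from one special word, it reaches every Gauss word of rank
  \<open>1\<close> to \<open>4\<close>. A factor \<open>2\<close> or \<open>4\<close> turns the coefficients
  into multiples that have been reached already, such as even ones in rank \<open>4\<close>. The comments name
  what the entries below them contribute, up to sign, with the letters written \<open>A\<close>, \<open>B\<close>,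
  \<open>C\<close>, \<open>D\<close> in order of appearance.\<close>

definition certificate :: "(int \<times> move) list" where
  "certificate = [
    \<comment> \<open>ABABCDCD, ABCBCDAD, ABCDCDAB, ABCDCDBA, 2 * ABCBCA\<close>
    (1, Move3 0 1 2 [] [] [] [3, 4, 3, 4]),
    (1, Move3 0 1 2 [3] [] [] [4, 3, 4]),
    (1, Move3 0 1 2 [3, 4] [] [] [3, 4]),
    (1, Move3 0 1 2 [] [] [3, 4, 3, 4] []),
    (1, Move2 0 1 [] [3, 4, 3, 4] []),
    \<comment> \<open>ABCDCBDA, ABCDBDCA, ABACDCDB, ABCDBCDA, ABCBDCDA, ABCBCA\<close>
    (1, Move2 0 1 [3] [4] [4, 3]),
    (1, Move2 0 1 [3, 4] [4] [3]),
    (1, Move3 0 1 2 [3, 4, 3] [] [] [4]),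
    (1, Move3 0 1 2 [3] [] [4] [4, 3]),
    (1, Move3 0 1 2 [3] [4] [4] [3]),
    (1, Move3 0 1 2 [3] [] [] [3]),
    \<comment> \<open>4 * ABACBC, 4 * ABAB, 2 * ABCBAC\<close>
    (2, Move2 0 1 [3] [3, 4] [4]),
    (4, Move3 0 1 2 [] [] [] []),
    (2, Move2 0 1 [] [3] [3]),
    \<comment> \<open>ABCDCBAD, ABCDBADC, 2 * ABCACB, ABCDADCB, ABCDCABD, ABCDBCAD\<close>
    (1, Move2 0 1 [] [3, 4, 3] [4]),
    (1, Move2 0 1 [3, 4] [4, 3] []),
    (1, Move2 0 1 [] [3, 4] [4, 3]),
    (1, Move2 0 1 [3] [4, 3, 4] []),
    (1, Move3 0 1 2 [] [] [3, 4, 3] [4]),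
    (1, Move3 0 1 2 [3] [] [4] [3, 4]),
    \<comment> \<open>ABCDADBC, ABCDACDB, ABCDABDC, 2 * ABCABC, ABCDBACD, ABCDACBD, ABCDABCD\<close>
    (1, Move3 0 1 2 [3] [] [4, 3, 4] []),
    (1, Move3 0 1 2 [3, 4] [] [3] [4]),
    (1, Move3 0 1 2 [] [] [3, 4] [4, 3]),
    (1, Move2 0 1 [3, 4] [3, 4] []),
    (1, Move2 0 1 [] [3, 4] [3, 4]),
    (1, Move2 0 1 [3] [4, 3] [4]),
    (1, Move3 0 1 2 [] [] [3, 4] [3, 4]),
    \<comment> \<open>ABCADBCD, ABCADCBD, 2 * ABACBC, ABCBADCD, ABACDBDC, ABCABDCD\<close>
    (1, Move3 0 1 2 [] [3, 4] [3, 4] []),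
    (1, Move3 0 1 2 [3] [] [3, 4] [4]),
    (1, Move2 0 1 [3] [3, 4] [4]),
    (1, Move2 0 1 [] [3] [4, 3, 4]),
    (1, Move2 0 1 [3, 4, 3] [4] []),
    (1, Move3 0 1 2 [] [] [3] [4, 3, 4]),
    \<comment> \<open>ABCBDACD, ABCBDADC, ABCDCADB, ABCBDCAD, ABACDBCD\<close>
    (1, Move3 0 1 2 [] [3] [4] [3, 4]),
    (1, Move3 0 1 2 [3] [4] [3] [4]),
    (1, Move3 0 1 2 [3] [4] [3, 4] []),
    (1, Move3 0 1 2 [] [3, 4, 3] [4] []),
    (1, Move3 0 1 2 [] [3] [4, 3] [4]),
    \<comment> \<open>ABCADCDB, ABCADBDC, ABACBDCD, ABCACDBD, ABCDBDAC\<close>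
    (1, Move3 0 1 2 [3] [4, 3] [4] []),
    (1, Move3 0 1 2 [] [3] [4] [4, 3]),
    (1, Move3 0 1 2 [3] [3, 4] [4] []),
    (1, Move3 0 1 2 [] [3] [3, 4] [4]),
    (1, Move3 0 1 2 [] [3] [4, 3, 4] []),
    \<comment> \<open>2 * ABAB, ABCBAC, ABCACB, ABCABC, ABACBC, ABAB\<close>
    (2, Move3 0 1 2 [] [] [] []),
    (1, Move2 0 1 [] [3] [3]),
    (1, Move2 0 1 [3] [3] []),
    (1, Move3 0 1 2 [] [] [3] [3]),
    (1, Move3 0 1 2 [] [3] [3] []),
    (1, Move3 0 1 2 [] [] [] [])]"

definition reaches_all_words :: "(int \<times> word) list \<Rightarrow> bool" where
  "reaches_all_words facts =
    list_all (\<lambda>n. list_all (\<lambda>w. reached facts (1, normal_form w)) (chord_words n)) [1, 2, 3, 4]"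

lemma certificate_complete:
  "reaches_all_words (foldl propagate [(1, normal_form (hd v4_words))] certificate)"
  by code_simp

lemma gauss_word_hd_v4: "gauss_word (hd v4_words)" and special_hd_v4: "special (hd v4_words)"
  and hd_v4_nonempty: "hd v4_words \<noteq> []" and rank_hd_v4: "rank (hd v4_words) = 4"
  using gauss_word_v4_words by (simp_all add: v4_words_def special_def rank_def card_insert_if)

text \<open>Rank \<open>0\<close> is one of the two generators and rank above \<open>4\<close> is truncated; the
  certificate does the rest.\<close>

lemma gen_in_span:
  assumes "gauss_word w"
  shows "gen w \<in> span"
proof -
  consider "w = []" | "rank w > 4" | "rank w \<in> set [1, 2, 3, 4]"
  proof -
    have "rank w = 0 \<or> rank w > 4 \<or> rank w = 1 \<or> rank w = 2 \<or> rank w = 3 \<or> rank w = 4"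
      by arith
    then show ?thesis
      using that length_gauss_word[OF assms] by auto
  qed
  then show ?thesis
  proof cases
    case 1
    then show ?thesis by (simp add: gen_generators_in_span)
  next
    case 2
    with assms show ?thesis
      by (intro span_relations relator_relations relators.R4)
  next
    case 3
    let ?facts = "foldl propagate [(1, normal_form (hd v4_words))] certificate"
    obtain f where f: "inj_on f (set w)" "map f w \<in> set (chord_words (rank w))"
      using chord_words_complete[OF assms length_gauss_word[OF assms]] by blast
    have g: "gauss_word (map f w)" "gauss_word (normal_form (map f w))"
      using assms f(1) by (simp_all add: gauss_word_map gauss_word_normal_form)
    have "gauss_word (hd v4_words)"
      using gauss_word_v4_words by (simp add: v4_words_def)
    then have "facts_hold [(1, normal_form (hd v4_words))]"
      by (simp add: facts_hold_def gen_normal_form gen_generators_in_span)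
    then have "facts_hold ?facts"
      by (rule facts_hold_foldl)
    moreover have "reached ?facts (1, normal_form (map f w))"
      using certificate_complete f(2) 3 unfolding reaches_all_words_def list_all_iff by blast
    ultimately have "frag_cmul 1 (gen (normal_form (map f w))) \<in> span"
      using g(2) reached_in_span by blast
    then show ?thesis
      by (simp add: gen_normal_form g(1) gen_map assms f(1))
  qed
qed

lemma in_span: "p \<in> carrier word_group \<Longrightarrow> p \<in> span"
proof -
  assume "p \<in> carrier word_group"
  then have "Poly_Mapping.keys p \<subseteq> iso_classes" by simp
  then show "p \<in> span"
  proof (rule free_Abelian_group_induct)
    fix c assume "c \<in> iso_classes"
    then obtain w where "gauss_word w" "c = iso_rel `` {w}"
      by (auto simp: iso_classes_def quotient_def)
    then show "frag_of c \<in> span"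
      using gen_in_span by (simp add: gen_def)
  qed (simp_all add: span_zero span_diff)
qed

text \<open>An element of the kernel is a relation plus \<open>a * [] + b * g\<close>, where \<open>g\<close> is
  a special word. As relations have coordinates \<open>0\<close>, this forces \<open>a = 0\<close> and
  \<open>b\<close> even, and \<open>2 * g\<close> is a relation by lemma \<open>twice_gen\<close>.\<close>

lemma kernel_coordinates:
  "kernel word_group (integer_group \<times>\<times> integer_mod_group 2) coordinates = relations 4"
proof (rule antisym[OF _ relations_subset_kernel], rule subsetI)
  fix p assume p: "p \<in> kernel word_group (integer_group \<times>\<times> integer_mod_group 2) coordinates"
  then have "p \<in> span"
    by (intro in_span) (simp add: kernel_def)
  then obtain a b where ab: "p - frag_cmul a (gen []) - frag_cmul b (gen (hd v4_words)) \<in> relations 4"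
    (is "?r \<in> _")
    by (auto simp: span_def)
  have "coordinates p = (0, 0)" "coordinates ?r = (0, 0)"
    using p subsetD[OF relations_subset_kernel ab] by (simp_all add: kernel_def integer_group_def)
  moreover have "\<not> special []"
    using special_length by fastforce
  ultimately have "a = 0" "even b"
    by (simp_all add: coordinates_def constant_part_gen weight_gen gauss_word_hd_v4 special_hd_v4
        hd_v4_nonempty) presburger+
  then obtain k where "b = k * 2"
    by (auto elim: evenE)
  then have "p = ?r + frag_cmul k (frag_cmul 2 (gen (hd v4_words)))"
    using \<open>a = 0\<close> by simp
  moreover have "frag_cmul k (frag_cmul 2 (gen (hd v4_words))) \<in> relations 4"
    by (intro relations_cmul twice_gen gauss_word_hd_v4 hd_v4_nonempty rank_hd_v4)
  ultimately show "p \<in> relations 4"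
    using ab relations_add by metis
qed

lemma coordinates_surj: "coordinates ` carrier word_group = carrier (integer_group \<times>\<times> integer_mod_group 2)"
proof
  show "coordinates ` carrier word_group \<subseteq> carrier (integer_group \<times>\<times> integer_mod_group 2)"
    by (rule hom_carrier[OF coordinates_hom])
  show "carrier (integer_group \<times>\<times> integer_mod_group 2) \<subseteq> coordinates ` carrier word_group"
  proof
    fix ab assume "ab \<in> carrier (integer_group \<times>\<times> integer_mod_group 2)"
    then obtain a b where ab: "ab = (a, b)" "0 \<le> b" "b < 2"
      by (auto simp: integer_mod_group_def)
    have "\<not> special []"
      using special_length by fastforce
    let ?p = "frag_cmul a (gen []) + frag_cmul b (gen (hd v4_words))"
    have "coordinates ?p = ab"
      using ab \<open>\<not> special []\<close>
      by (simp add: coordinates_def constant_part_gen weight_gen gauss_word_hd_v4 special_hd_v4 hd_v4_nonempty)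
    moreover have "?p \<in> carrier word_group"
      using keys_cmul[of a "gen []"] keys_cmul[of b "gen (hd v4_words)"] keys_gen[of "[]"] keys_gen[OF gauss_word_hd_v4]
      by (simp del: keys_cmul_iff add: keys_add_subset)
    ultimately show "ab \<in> coordinates ` carrier word_group"
      by (metis imageI)
  qed
qed

theorem universal_group_4: "universal_group 4 \<cong> integer_group \<times>\<times> integer_mod_group 2"
  using group_hom.FactGroup_iso[OF group_hom_coordinates coordinates_surj]
  by (simp add: universal_group_def kernel_coordinates)

section \<open>Fully marked words\<close>

lemma equiv_homotopy_rel: "equiv {w. gauss_word w} homotopy_rel"
  by (rule equivI) (auto simp: homotopy_rel_def refl_on_def sym_on_def trans_on_def intro: equivclp_sym equivclp_trans)

lemma homotopy_class_move:
  assumes "homotopy_move u w"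
  shows "homotopy_class u = homotopy_class w"
proof -
  have "gauss_word u" "gauss_word w"
    using assms by (cases; simp)+
  then have "(u, w) \<in> homotopy_rel"
    using assms by (simp add: homotopy_rel_def r_into_equivclp)
  then show ?thesis
    unfolding homotopy_class_def by (rule equiv_class_eq[OF equiv_homotopy_rel])
qed

lemma homotopy_class_in_homotopy_classes: "gauss_word w \<Longrightarrow> homotopy_class w \<in> homotopy_classes"
  by (simp add: homotopy_class_def homotopy_classes_def quotientI)

lemma homotopy_class_map: "gauss_word w \<Longrightarrow> inj_on f (set w) \<Longrightarrow> homotopy_class (map f w) = homotopy_class w"
  by (metis gauss_word_isomorphic homotopy_class_move homotopy_move.iso isomorphic_map_iff)

lemma delete_letters_append [simp]: "delete_letters S (u @ w) = delete_letters S u @ delete_letters S w"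
  and delete_letters_Cons [simp]: "delete_letters S (a # w) = (if a \<in> S then delete_letters S w else a # delete_letters S w)"
  and delete_letters_Nil [simp]: "delete_letters S [] = []"
  and delete_letters_empty [simp]: "delete_letters {} w = w"
  and set_delete_letters [simp]: "set (delete_letters S w) = set w - S"
  by (auto simp: delete_letters_def)

lemma delete_letters_delete_letters [simp]:
  "delete_letters S (delete_letters T w) = delete_letters (S \<union> T) w"
  by (simp add: delete_letters_def conj_commute)

lemma delete_letters_idle: "a \<notin> set w \<Longrightarrow> delete_letters {a} w = w"
  by (auto simp: delete_letters_def filter_id_conv)

lemma delete_letters_map:
  "inj_on f (insert a (set w)) \<Longrightarrow> delete_letters {f a} (map f w) = map f (delete_letters {a} w)"
  unfolding delete_letters_def by (auto simp: filter_map comp_def inj_on_def intro!: arg_cong[of _ _ "map f"] filter_cong)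

text \<open>The form in which homotopy moves enter: a move on letters outside \<open>As\<close> survives every
  deletion of letters in \<open>As\<close>.\<close>

lemma semi_word_cong:
  assumes "\<And>S. S \<subseteq> set As \<Longrightarrow> homotopy_class (delete_letters S u) = homotopy_class (delete_letters S w)"
  shows "semi_word u As = semi_word w As"
  using assms
proof (induction As arbitrary: u w)
  case Nil
  from Nil[of "{}"] show ?case by simp
next
  case (Cons A As)
  have "semi_word u As = semi_word w As"
    by (rule Cons.IH, rule Cons.prems) auto
  moreover have "semi_word (delete_letters {A} u) As = semi_word (delete_letters {A} w) As"
  proof (rule Cons.IH)
    fix S assume "S \<subseteq> set As"
    then show "homotopy_class (delete_letters S (delete_letters {A} u)) =
        homotopy_class (delete_letters S (delete_letters {A} w))"
      using Cons.prems[of "S \<union> {A}"] by auto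
  qed
  ultimately show ?case by simp
qed

lemma semi_word_move_to_front: "semi_word w (As @ A # Bs) = semi_word w (A # As @ Bs)"
  by (induction As arbitrary: w) (simp_all add: insert_commute)

lemma semi_word_perm: "mset As = mset Bs \<Longrightarrow> semi_word w As = semi_word w Bs"
proof (induction As arbitrary: Bs w)
  case (Cons A As)
  then obtain xs ys where Bs: "Bs = xs @ A # ys"
    by (metis list.set_intros(1) mset_eq_setD split_list)
  with Cons.prems have "mset As = mset (xs @ ys)" by simp
  then have "semi_word w As = semi_word w (xs @ ys)"
    "semi_word (delete_letters {A} w) As = semi_word (delete_letters {A} w) (xs @ ys)"
    by (rule Cons.IH)+
  then show ?case
    unfolding Bs semi_word_move_to_front by simp
qed simp

text \<open>The choice of an order is harmless by lemma \<open>fully_marked_eq\<close>.\<close>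

definition fully_marked :: "word \<Rightarrow> (word set \<Rightarrow>\<^sub>0 int)" where
  "fully_marked w = semi_word w (remdups w)"

lemma fully_marked_eq: "distinct As \<Longrightarrow> set As = set w \<Longrightarrow> fully_marked w = semi_word w As"
  unfolding fully_marked_def
  by (rule semi_word_perm) (metis distinct_remdups set_eq_iff_mset_eq_distinct set_remdups)

lemma semi_word_map:
  assumes "gauss_word w" "inj_on f (set w \<union> set As)"
  shows "semi_word (map f w) (map f As) = semi_word w As"
  using assms
proof (induction As arbitrary: w)
  case Nil
  then show ?case by (simp add: homotopy_class_map)
next
  case (Cons A As)
  have "delete_letters {f A} (map f w) = map f (delete_letters {A} w)"
    by (rule delete_letters_map) (rule inj_on_subset[OF Cons.prems(2)], auto)
  moreover have "semi_word (map f w) (map f As) = semi_word w As"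
    by (rule Cons.IH) (use Cons.prems in \<open>auto intro: inj_on_subset\<close>)
  moreover have "semi_word (map f (delete_letters {A} w)) (map f As) = semi_word (delete_letters {A} w) As"
    by (rule Cons.IH) (use Cons.prems in \<open>auto intro: inj_on_subset gauss_word_delete_letters\<close>)
  ultimately show ?case by simp
qed

lemma fully_marked_isomorphic:
  assumes "gauss_word u" "isomorphic u w"
  shows "fully_marked u = fully_marked w"
proof -
  obtain f where f: "inj_on f (set u)" and w: "w = map f u"
    using assms(2) by (auto simp: isomorphic_map_iff)
  have "fully_marked w = semi_word w (map f (remdups u))"
    by (rule fully_marked_eq) (use f in \<open>auto simp: w distinct_map\<close>)
  then show ?thesis
    unfolding fully_marked_def w by (simp add: semi_word_map assms(1) f)
qed

text \<open>Removing \<open>AA\<close> is a homotopy, whatever is done to the other letters. So the two terms of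
  the expansion in \<open>A\<close> cancel.\<close>

lemma fully_marked_R1:
  assumes "gauss_word (x @ [A, A] @ y)"
  shows "fully_marked (x @ [A, A] @ y) = 0"
proof -
  let ?w = "x @ [A, A] @ y" and ?As = "remdups (x @ y)"
  have A: "A \<notin> set (x @ y)" and xy: "gauss_word (x @ y)"
    using assms gauss_word_insert[of x A "[]" y] by auto
  have "fully_marked ?w = semi_word ?w (A # ?As)"
    by (rule fully_marked_eq) (use A in auto)
  moreover have "delete_letters {A} ?w = x @ y"
    using A by (simp add: delete_letters_idle)
  moreover have "semi_word ?w ?As = semi_word (x @ y) ?As"
  proof (rule semi_word_cong, rule homotopy_class_move)
    fix S assume "S \<subseteq> set ?As"
    with A have "A \<notin> S" by auto
    then show "homotopy_move (delete_letters S ?w) (delete_letters S (x @ y))"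
      using homotopy_move.H1[of "delete_letters S x" A "delete_letters S y"]
        gauss_word_delete_letters[OF assms, of S] gauss_word_delete_letters[OF xy, of S] by simp
  qed
  ultimately show ?thesis by simp
qed

text \<open>Expand in \<open>A\<close> and \<open>B\<close> only, keeping the other letters marked. With
  \<open>p\<close>, \<open>q\<close>, \<open>r\<close> for the three words and \<open>u = xyz\<close>, the sum
  is \<open>(p - q - r + u) + (q - u) + (r - u) = p - u\<close>, and \<open>p\<close> and \<open>u\<close> are
  related by the second move.\<close>

lemma fully_marked_Move2:
  assumes "admissible (Move2 A B x y z)"
  shows "fully_marked (x @ [A, B] @ y @ [B, A] @ z) + fully_marked (x @ [A] @ y @ [A] @ z) + fully_marked (x @ [B] @ y @ [B] @ z) = 0"
proof -
  let ?u = "x @ y @ z" and ?As = "remdups (x @ y @ z)"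
  have AB: "A \<noteq> B" "A \<notin> set ?u" "B \<notin> set ?u" and u: "gauss_word ?u"
    using assms unfolding admissible_Move2 by (auto simp: gauss_word_Cons_Cons)
  let ?p = "x @ [A, B] @ y @ [B, A] @ z" and ?q = "x @ [A] @ y @ [A] @ z" and ?r = "x @ [B] @ y @ [B] @ z"
  have p: "gauss_word ?p"
    using assms unfolding admissible_Move2 gauss_word_Move2 .
  have del: "delete_letters {A} ?p = ?r" "delete_letters {B} ?p = ?q"
      "delete_letters {A} ?q = ?u" "delete_letters {B} ?r = ?u"
    using AB by (simp_all add: delete_letters_idle)
  have "fully_marked ?p = semi_word ?p (A # B # ?As)" "fully_marked ?q = semi_word ?q (A # ?As)"
    "fully_marked ?r = semi_word ?r (B # ?As)"
    by (rule fully_marked_eq; use AB in auto)+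
  moreover have "semi_word ?p ?As = semi_word ?u ?As"
  proof (rule semi_word_cong, rule homotopy_class_move)
    fix S assume "S \<subseteq> set ?As"
    with AB have "A \<notin> S" "B \<notin> S" by auto
    then show "homotopy_move (delete_letters S ?p) (delete_letters S ?u)"
      using homotopy_move.H2[of "delete_letters S x" A B "delete_letters S y" "delete_letters S z"]
        gauss_word_delete_letters[OF p, of S] gauss_word_delete_letters[OF u, of S] by simp
  qed
  ultimately show ?thesis
    by (simp only: semi_word.simps del) simp
qed

text \<open>Expand in \<open>A\<close>, \<open>B\<close>, \<open>C\<close> only. On each side the terms with two
  of these letters cancel, and there remains the leading word minus \<open>xAyAzt\<close>,
  \<open>xByzBt\<close>, \<open>xyCzCt\<close> plus twice \<open>xyzt\<close>. The subtracted and added words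
  are the same on both sides, and the leading words are related by the third move.\<close>

lemma fully_marked_Move3:
  assumes "admissible (Move3 A B C x y z t)"
  shows "fully_marked (x @ [A, B] @ y @ [A, C] @ z @ [B, C] @ t)
      + fully_marked (x @ [A, B] @ y @ [A] @ z @ [B] @ t)
      + fully_marked (x @ [A] @ y @ [A, C] @ z @ [C] @ t)
      + fully_marked (x @ [B] @ y @ [C] @ z @ [B, C] @ t)
    = fully_marked (x @ [B, A] @ y @ [C, A] @ z @ [C, B] @ t)
      + fully_marked (x @ [B, A] @ y @ [A] @ z @ [B] @ t)
      + fully_marked (x @ [A] @ y @ [C, A] @ z @ [C] @ t)
      + fully_marked (x @ [B] @ y @ [C] @ z @ [C, B] @ t)"
    (is "fully_marked ?p + fully_marked ?pC + fully_marked ?pB + fully_marked ?pA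
       = fully_marked ?q + fully_marked ?qC + fully_marked ?qB + fully_marked ?qA")
proof -
  let ?u = "x @ y @ z @ t" and ?As = "remdups (x @ y @ z @ t)"
  have ABC: "distinct [A, B, C]" "A \<notin> set ?u" "B \<notin> set ?u" "C \<notin> set ?u"
    using assms unfolding admissible_Move3 by (auto simp: gauss_word_Cons_Cons)
  have pq: "gauss_word ?p" "gauss_word ?q"
    using assms unfolding admissible_Move3 gauss_word_Move3 by simp_all
  let ?a = "x @ [A] @ y @ [A] @ z @ t" and ?b = "x @ [B] @ y @ z @ [B] @ t" and ?c = "x @ y @ [C] @ z @ [C] @ t"
  have del:
    "delete_letters {A} ?p = ?pA" "delete_letters {B} ?p = ?pB" "delete_letters {C} ?p = ?pC"
    "delete_letters {A} ?q = ?qA" "delete_letters {B} ?q = ?qB" "delete_letters {C} ?q = ?qC"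
    "delete_letters {B} ?pA = ?c" "delete_letters {C} ?pA = ?b" "delete_letters {A} ?pB = ?c"
    "delete_letters {C} ?pB = ?a" "delete_letters {A} ?pC = ?b" "delete_letters {B} ?pC = ?a"
    "delete_letters {B} ?qA = ?c" "delete_letters {C} ?qA = ?b" "delete_letters {A} ?qB = ?c"
    "delete_letters {C} ?qB = ?a" "delete_letters {A} ?qC = ?b" "delete_letters {B} ?qC = ?a"
    "delete_letters {A} ?a = ?u" "delete_letters {B} ?b = ?u" "delete_letters {C} ?c = ?u"
    using ABC by (simp_all add: delete_letters_idle)
  have "fully_marked ?p = semi_word ?p (A # B # C # ?As)" "fully_marked ?q = semi_word ?q (A # B # C # ?As)"
    "fully_marked ?pA = semi_word ?pA (B # C # ?As)" "fully_marked ?qA = semi_word ?qA (B # C # ?As)"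
    "fully_marked ?pB = semi_word ?pB (A # C # ?As)" "fully_marked ?qB = semi_word ?qB (A # C # ?As)"
    "fully_marked ?pC = semi_word ?pC (A # B # ?As)" "fully_marked ?qC = semi_word ?qC (A # B # ?As)"
    by (rule fully_marked_eq; use ABC in auto)+
  moreover have "semi_word ?p ?As = semi_word ?q ?As"
  proof (rule semi_word_cong, rule homotopy_class_move)
    fix S assume "S \<subseteq> set ?As"
    with ABC have "A \<notin> S" "B \<notin> S" "C \<notin> S" by auto
    then show "homotopy_move (delete_letters S ?p) (delete_letters S ?q)"
      using homotopy_move.H3[of "delete_letters S x" A B "delete_letters S y" C "delete_letters S z" "delete_letters S t"]
        gauss_word_delete_letters[OF pq(1), of S] gauss_word_delete_letters[OF pq(2), of S] by simp
  qed
  ultimately show ?thesis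
    by (simp only: semi_word.simps del) simp
qed

text \<open>Applied to one letter after the other: a word is the sum of itself with that letter marked and of
  itself with that letter deleted.\<close>

lemma semi_word_expansion:
  assumes "distinct As"
  shows "semi_word w Bs = (\<Sum>S\<in>Pow (set As). semi_word (delete_letters S w) (filter (\<lambda>a. a \<notin> S) As @ Bs))"
  using assms
proof (induction As arbitrary: w Bs)
  case (Cons A As)
  let ?f = "\<lambda>S. semi_word (delete_letters S w) (filter (\<lambda>a. a \<notin> S) (A # As) @ Bs)"
  have A: "A \<notin> set As" "distinct As" using Cons.prems by auto
  have *: "(\<Sum>S\<in>Pow (set (A # As)). ?f S) = (\<Sum>S\<in>Pow (set As). ?f S) + (\<Sum>S\<in>Pow (set As). ?f (insert A S))"
  proof -
    have "Pow (set (A # As)) = Pow (set As) \<union> insert A ` Pow (set As)"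
      by (simp add: Pow_insert)
    moreover have "Pow (set As) \<inter> insert A ` Pow (set As) = {}"
      using A by auto
    moreover have "inj_on (insert A) (Pow (set As))"
      using A by (auto simp: inj_on_def)
    ultimately show ?thesis
      by (simp add: sum.union_disjoint sum.reindex)
  qed
  have "(\<Sum>S\<in>Pow (set As). ?f S) = semi_word w (A # Bs)"
    unfolding Cons.IH[OF A(2), of w "A # Bs"]
  proof (rule sum.cong)
    fix S assume "S \<in> Pow (set As)"
    then have "filter (\<lambda>a. a \<notin> S) (A # As) @ Bs = A # filter (\<lambda>a. a \<notin> S) As @ Bs"
      using A by auto
    then show "?f S = semi_word (delete_letters S w) (filter (\<lambda>a. a \<notin> S) As @ A # Bs)"
      by (simp only: semi_word_move_to_front)
  qed simp
  moreover have "(\<Sum>S\<in>Pow (set As). ?f (insert A S)) = semi_word (delete_letters {A} w) Bs"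
    unfolding Cons.IH[OF A(2), of "delete_letters {A} w" Bs]
  proof (rule sum.cong)
    fix S assume "S \<in> Pow (set As)"
    have "filter (\<lambda>a. a \<notin> insert A S) (A # As) = filter (\<lambda>a. a \<notin> S) As"
      using A by (auto intro: filter_cong)
    then show "?f (insert A S) = semi_word (delete_letters S (delete_letters {A} w)) (filter (\<lambda>a. a \<notin> S) As @ Bs)"
      by simp
  qed simp
  ultimately show ?case
    unfolding * by simp
qed simp

text \<open>The Moebius inversion of the alternating sum that defines a fully marked word.\<close>

lemma homotopy_class_expansion:
  "frag_of (homotopy_class w) = (\<Sum>S\<in>Pow (set w). fully_marked (delete_letters S w))"
proof -
  have "frag_of (homotopy_class w) = (\<Sum>S\<in>Pow (set w). semi_word (delete_letters S w) (filter (\<lambda>a. a \<notin> S) (remdups w)))"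
    using semi_word_expansion[of "remdups w" w "[]"] by simp
  also have "\<dots> = (\<Sum>S\<in>Pow (set w). fully_marked (delete_letters S w))"
    by (intro sum.cong refl, rule fully_marked_eq[symmetric]) auto
  finally show ?thesis .
qed

lemma keys_semi_word: "gauss_word w \<Longrightarrow> Poly_Mapping.keys (semi_word w As) \<subseteq> homotopy_classes"
proof (induction As arbitrary: w)
  case (Cons A As)
  then show ?case
    unfolding semi_word.simps by (intro keys_diff_subset Cons.IH gauss_word_delete_letters)
qed (simp add: homotopy_class_in_homotopy_classes)

text \<open>The linear map that marks all letters. It is defined on isomorphism classes, so a representative is
  chosen; lemma \<open>fully_marked_isomorphic\<close> shows that the choice does not matter.\<close>

definition semi_extend :: "(word set \<Rightarrow>\<^sub>0 int) \<Rightarrow> (word set \<Rightarrow>\<^sub>0 int)" where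
  "semi_extend = frag_extend (\<lambda>c. fully_marked (SOME w. w \<in> c))"

lemma semi_extend_gen:
  assumes "gauss_word w"
  shows "semi_extend (gen w) = fully_marked w"
proof -
  have in_class: "u \<in> iso_rel `` {w} \<longleftrightarrow> isomorphic w u" for u
    using iso_class_eq[OF assms] by (simp add: isomorphic_iff_normal_form eq_commute)
  have "w \<in> iso_rel `` {w}"
    by (simp only: in_class isomorphic_iff_normal_form)
  then have "isomorphic w (SOME u. u \<in> iso_rel `` {w})"
    unfolding in_class[symmetric] by (rule someI)
  then show ?thesis
    by (simp add: semi_extend_def gen_def fully_marked_isomorphic[OF assms])
qed

lemma semi_extend_linear:
  "semi_extend (p + q) = semi_extend p + semi_extend q"
  "semi_extend (p - q) = semi_extend p - semi_extend q"
  "semi_extend (frag_cmul c p) = frag_cmul c (semi_extend p)"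
  by (simp_all add: semi_extend_def frag_extend_add frag_extend_diff frag_extend_cmul)

lemma semi_extend_sum: "finite I \<Longrightarrow> semi_extend (\<Sum>i\<in>I. f i) = (\<Sum>i\<in>I. semi_extend (f i))"
  by (induction I rule: finite_induct) (auto simp: semi_extend_linear, simp add: semi_extend_def)

lemma keys_semi_extend:
  assumes "Poly_Mapping.keys p \<subseteq> iso_classes"
  shows "Poly_Mapping.keys (semi_extend p) \<subseteq> homotopy_classes"
  using assms
proof (rule free_Abelian_group_induct)
  fix c assume "c \<in> iso_classes"
  then obtain w where "gauss_word w" "c = iso_rel `` {w}"
    by (auto simp: iso_classes_def quotient_def)
  then show "Poly_Mapping.keys (semi_extend (frag_of c)) \<subseteq> homotopy_classes"
    using semi_extend_gen[of w] keys_semi_word[of w] by (simp add: gen_def fully_marked_def)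
qed (simp_all add: semi_extend_linear keys_diff_subset, simp add: semi_extend_def)

lemma semi_extend_lincomb_terms:
  assumes "admissible I"
  shows "semi_extend (lincomb (terms I)) = 0"
proof -
  have *: "semi_extend (lincomb ts) = (\<Sum>(c, w)\<leftarrow>ts. frag_cmul c (fully_marked w))"
    if "\<forall>(c, w) \<in> set ts. gauss_word w" for ts
    using that
    by (induction ts) (auto simp: lincomb_def semi_extend_linear semi_extend_gen, simp add: semi_extend_def)
  show ?thesis
    unfolding *[OF admissible_gauss_word[OF assms]]
  proof (cases I)
    case (Move2 A B x y z)
    then show "(\<Sum>(c, w)\<leftarrow>terms I. frag_cmul c (fully_marked w)) = 0"
      using fully_marked_Move2[of A B x y z] assms by (simp add: add.assoc)
  next
    case (Move3 A B C x y z t)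
    then show "(\<Sum>(c, w)\<leftarrow>terms I. frag_cmul c (fully_marked w)) = 0"
      using fully_marked_Move3[of A B C x y z t] assms by (simp add: algebra_simps)
  qed
qed

section \<open>Finite type invariants\<close>

context
  fixes H :: "('h, 'm) monoid_scheme" and v :: "word set \<Rightarrow> 'h"
  assumes H: "comm_group H" and v: "homotopy_invariant H v"
begin

interpretation H: comm_group H by (rule H)

lemma v_closed: "c \<in> homotopy_classes \<Longrightarrow> v c \<in> carrier H"
  using v by (auto simp: homotopy_invariant_def)

text \<open>Evaluating sums over a common finite support makes additivity a termwise matter.\<close>

lemma linear_ext_superset:
  assumes "finite K" "Poly_Mapping.keys p \<subseteq> K" "K \<subseteq> homotopy_classes"
  shows "linear_ext H v p = finprod H (\<lambda>c. v c [^]\<^bsub>H\<^esub> Poly_Mapping.lookup p c) K"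
  unfolding linear_ext_def
  by (rule H.finprod_mono_neutral_cong_left)
    (use assms v_closed in \<open>auto simp: not_in_keys_iff_lookup_eq_zero subset_iff\<close>)

lemma linear_ext_frag_of: "c \<in> homotopy_classes \<Longrightarrow> linear_ext H v (frag_of c) = v c"
  by (simp add: linear_ext_def v_closed)

lemma linear_ext_hom: "linear_ext H v \<in> hom (free_Abelian_group homotopy_classes) H"
proof (rule homI)
  fix p assume "p \<in> carrier (free_Abelian_group homotopy_classes)"
  then show "linear_ext H v p \<in> carrier H"
    unfolding linear_ext_def using v_closed by (intro H.finprod_closed) auto
next
  fix p q
  assume "p \<in> carrier (free_Abelian_group homotopy_classes)" "q \<in> carrier (free_Abelian_group homotopy_classes)"
  then have pq: "Poly_Mapping.keys p \<union> Poly_Mapping.keys q \<subseteq> homotopy_classes" (is "?K \<subseteq> _")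
    by simp
  have "linear_ext H v (p + q) = finprod H (\<lambda>c. v c [^]\<^bsub>H\<^esub> Poly_Mapping.lookup (p + q) c) ?K"
    by (rule linear_ext_superset[OF _ keys_add pq]) simp
  also have "\<dots> = finprod H (\<lambda>c. v c [^]\<^bsub>H\<^esub> Poly_Mapping.lookup p c \<otimes>\<^bsub>H\<^esub> v c [^]\<^bsub>H\<^esub> Poly_Mapping.lookup q c) ?K"
    using pq v_closed by (intro H.finprod_cong) (auto simp: simp_implies_def subset_iff lookup_add H.int_pow_mult)
  also have "\<dots> = finprod H (\<lambda>c. v c [^]\<^bsub>H\<^esub> Poly_Mapping.lookup p c) ?K
      \<otimes>\<^bsub>H\<^esub> finprod H (\<lambda>c. v c [^]\<^bsub>H\<^esub> Poly_Mapping.lookup q c) ?K"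
    using pq v_closed by (intro H.finprod_multf) auto
  also have "\<dots> = linear_ext H v p \<otimes>\<^bsub>H\<^esub> linear_ext H v q"
    using linear_ext_superset[of ?K p] linear_ext_superset[of ?K q] pq by simp
  finally show "linear_ext H v (p \<otimes>\<^bsub>free_Abelian_group homotopy_classes\<^esub> q) = linear_ext H v p \<otimes>\<^bsub>H\<^esub> linear_ext H v q"
    by simp
qed

lemma linear_ext_semi_extend_hom: "linear_ext H v \<circ> semi_extend \<in> hom word_group H"
  using _ linear_ext_hom
  by (rule hom_compose) (rule homI, simp_all add: keys_semi_extend semi_extend_linear)

text \<open>Universality: an invariant that vanishes on words with more than \<open>n\<close> semi-letters
  induces a homomorphism on the universal group of degree \<open>n\<close>.\<close>

lemma linear_ext_semi_extend_relations:
  assumes "vanishes_above H v n" "p \<in> relations n"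
  shows "linear_ext H v (semi_extend p) = \<one>\<^bsub>H\<^esub>"
proof -
  interpret group_hom word_group H "linear_ext H v \<circ> semi_extend"
    using linear_ext_semi_extend_hom by (simp add: group_hom_def group_hom_axioms_def H.group_axioms)
  have zero: "linear_ext H v 0 = \<one>\<^bsub>H\<^esub>"
    by (simp add: linear_ext_def)
  have "linear_ext H v (semi_extend p) = \<one>\<^bsub>H\<^esub>" if "p \<in> relators n" for p
    using that
  proof (cases rule: relators_cases)
    case (R1 x A y)
    then show ?thesis by (simp only: semi_extend_gen fully_marked_R1 zero)
  next
    case (move I)
    then show ?thesis by (simp only: semi_extend_lincomb_terms zero)
  next
    case (R4 w)
    then have "length (remdups w) > n"
      by (simp add: rank_def length_remdups_card_conv)
    then have "linear_ext H v (semi_word w (remdups w)) = \<one>\<^bsub>H\<^esub>"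
      using assms(1) R4(2) unfolding vanishes_above_def by simp
    then show ?thesis
      by (simp add: R4 semi_extend_gen fully_marked_def)
  qed
  then have "relators n \<subseteq> kernel word_group H (linear_ext H v \<circ> semi_extend)"
    using keys_relator by (auto simp: kernel_def)
  then have "relations n \<subseteq> kernel word_group H (linear_ext H v \<circ> semi_extend)"
    by (rule group.generate_subgroup_incl[OF group_free_Abelian_group]) (rule subgroup_kernel)
  with assms(2) show ?thesis
    by (auto simp: kernel_def)
qed

end

definition subword_sum :: "word \<Rightarrow> (word set \<Rightarrow>\<^sub>0 int)" where
  "subword_sum w = (\<Sum>S\<in>Pow (set w). gen (delete_letters S w))"

lemma keys_subword_sum: "gauss_word w \<Longrightarrow> Poly_Mapping.keys (subword_sum w) \<subseteq> iso_classes"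
  using sum_closed_free_Abelian_group[of "Pow (set w)" "\<lambda>S. gen (delete_letters S w)" iso_classes]
  by (simp add: subword_sum_def keys_gen gauss_word_delete_letters)

lemma semi_extend_subword_sum: "gauss_word w \<Longrightarrow> semi_extend (subword_sum w) = frag_of (homotopy_class w)"
  by (simp add: subword_sum_def semi_extend_sum semi_extend_gen gauss_word_delete_letters homotopy_class_expansion)

lemma lookup_subword_sum:
  assumes "gauss_word w" "gauss_word q"
  shows "Poly_Mapping.lookup (subword_sum w) (iso_rel `` {q}) = int (subword_count q w)"
proof -
  have "Poly_Mapping.lookup (subword_sum w) (iso_rel `` {q}) =
      (\<Sum>S\<in>Pow (set w). of_bool (isomorphic (delete_letters S w) q))"
    using assms by (simp add: subword_sum_def lookup_sum lookup_gen gauss_word_delete_letters)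
  also have "\<dots> = int (card {S \<in> Pow (set w). isomorphic (delete_letters S w) q})"
    by (simp add: of_bool_def sum.If_cases Int_def)
  finally show ?thesis
    by (simp add: subword_count_def)
qed

text \<open>The only empty subword arises from deleting all letters.\<close>

lemma coordinates_subword_sum:
  assumes "gauss_word w"
  shows "coordinates (subword_sum w) = (1, int (v4 w))"
proof -
  have "{S. S \<subseteq> set w \<and> isomorphic (delete_letters S w) []} = {set w}"
    by (auto simp: isomorphic_map_iff delete_letters_def filter_empty_conv)
  then have "constant_part (subword_sum w) = 1"
    using assms by (simp add: constant_part_def lookup_subword_sum subword_count_def)
  moreover have "weight (subword_sum w) = (\<Sum>q\<leftarrow>v4_words. int (subword_count q w))"
    using gauss_word_v4_words assms unfolding weight_def
    by (intro arg_cong[of _ _ sum_list] map_cong) (auto simp: lookup_subword_sum list_all_iff)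
  ultimately show ?thesis
    by (simp add: coordinates_def v4_def zmod_int comp_def flip: sum_list_of_nat)
qed

text \<open>The subword sums of \<open>w\<close> and \<open>w'\<close> have the same coordinates, so their
  difference is a relation. The invariant evaluates the fully marked version of this difference to
  \<open>1\<close>, and that version is the difference of the homotopy classes.\<close>

lemma invariant_determined_by_v4:
  fixes H :: "('h, 'm) monoid_scheme"
  assumes H: "comm_group H" and v: "homotopy_invariant H v" "vanishes_above H v 4"
    and w: "gauss_word w" "gauss_word w'" and eq: "v4 w = v4 w'"
  shows "v (homotopy_class w) = v (homotopy_class w')"
proof -
  let ?d = "subword_sum w - subword_sum w'"
  interpret H: comm_group H by (rule H)
  have "coordinates ?d = (0, 0)"
    using coordinates_subword_sum[OF w(1)] coordinates_subword_sum[OF w(2)] eq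
    by (simp add: coordinates_def) presburger
  moreover have keys: "Poly_Mapping.keys ?d \<subseteq> iso_classes"
    using w by (intro keys_diff_subset keys_subword_sum)
  ultimately have "?d \<in> relations 4"
    unfolding kernel_coordinates[symmetric] by (simp add: kernel_def integer_group_def)
  then have "linear_ext H v (semi_extend ?d) = \<one>\<^bsub>H\<^esub>"
    by (rule linear_ext_semi_extend_relations[OF H v])
  moreover have "linear_ext H v (semi_extend (?d + subword_sum w')) =
      linear_ext H v (semi_extend ?d) \<otimes>\<^bsub>H\<^esub> linear_ext H v (semi_extend (subword_sum w'))"
    using hom_mult[OF linear_ext_semi_extend_hom[OF H v(1)], of ?d "subword_sum w'"] keys keys_subword_sum[OF w(2)]
    by simp
  ultimately show ?thesis
    using w H v(1) by (simp add: semi_extend_subword_sum linear_ext_frag_of v_closed homotopy_class_in_homotopy_classes)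
qed

theorem theorem8p6:
  shows "universal_group 4 \<cong> integer_group \<times>\<times> integer_mod_group 2 \<and>
    (\<forall>(H :: ('h, 'm) monoid_scheme) v w w'.
       comm_group H \<and> finite_type_invariant H v \<and> ft_degree H v = 4 \<and>
       gauss_word w \<and> gauss_word w' \<and> v (homotopy_class w) \<noteq> v (homotopy_class w')
       \<longrightarrow> v4 w \<noteq> v4 w')"
proof (intro conjI allI impI universal_group_4)
  fix H :: "('h, 'm) monoid_scheme" and v w w'
  assume *: "comm_group H \<and> finite_type_invariant H v \<and> ft_degree H v = 4 \<and>
    gauss_word w \<and> gauss_word w' \<and> v (homotopy_class w) \<noteq> v (homotopy_class w')"
  then have "vanishes_above H v 4"
    by (metis LeastI_ex finite_type_invariant_def ft_degree_def)
  with * show "v4 w \<noteq> v4 w'"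
    using invariant_determined_by_v4[of H v w w'] by (auto simp: finite_type_invariant_def)
qed

end
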